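(* Let $\mu$ be a positive finite measure on $[0,1)$ and let $\Lambda=(\lambda_n)_{n\in\mathbb N}$ be a sequence of positive real numbers. If $\mu$ is sublinear and $\Lambda$ is lacunary, then $\mu$ is a Carleson measure for $M_\Lambda^q$, for any $q\in[1,+\infty)$.
   Context: $\mu$ is sublinear if there exists a constant $C>0$ such that $\mu([1-\varepsilon,1])\le C\varepsilon$ for all $\varepsilon\in(0,1)$ (with $\mu(\{1\})=0$). $\Lambda$ is lacunary if there exists $r>1$ such that $\lambda_{n+1}\ge r\lambda_n$ for every $n$. $M_\Lambda^q$ is the closed linear span of the monomials $t^{\lambda_n}$ in $L^q([0,1],m)$, $m$ the Lebesgue measure, with norm $\|\cdot\|_q$. $\mu$ is a Carleson measure for $M_\Lambda^q$ if there is a constant $C$ such that $\|f\|_{L^q(\mu)}\le C\|f\|_q$ for every Müntz polynomial $f(t)=\sum_na_nt^{\lambda_n}$ (finite sum). *)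

theory Defs
  imports "HOL-Analysis.Analysis"
begin

text \<open>
  Intersecting with the space lets the definition apply both to measures on \<open>[0,1]\<close> and to
  measures on \<open>[0,1)\<close>; the latter are thereby extended by \<open>\<mu>({1}) = 0\<close>.
\<close>

definition sublinear :: "real measure \<Rightarrow> bool" where
  "sublinear \<mu> \<longleftrightarrow>
     (\<exists>C>0. \<forall>\<epsilon>\<in>{0<..<1}. emeasure \<mu> ({1 - \<epsilon>..1} \<inter> space \<mu>) \<le> ennreal (C * \<epsilon>)) \<and>
     emeasure \<mu> ({1} \<inter> space \<mu>) = 0"

definition lacunary :: "(nat \<Rightarrow> real) \<Rightarrow> bool" where
  "lacunary \<Lambda> \<longleftrightarrow> (\<exists>r>1. \<forall>n. \<Lambda> (Suc n) \<ge> r * \<Lambda> n)"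

definition muntz_polynomials :: "(nat \<Rightarrow> real) \<Rightarrow> (real \<Rightarrow> complex) set" where
  "muntz_polynomials \<Lambda> =
     {f. \<exists>S a. finite S \<and> f = (\<lambda>t. \<Sum>n\<in>S. a n * complex_of_real (t powr \<Lambda> n))}"

text \<open>
  This is only meaningful when \<open>\<bar>f\<bar>\<^sup>q\<close> is integrable. That is automatic below, because
  Muntz polynomials with positive exponents are continuous and bounded on \<open>[0,1]\<close>
  and the measures are finite.
\<close>

definition Lq_norm :: "'a measure \<Rightarrow> real \<Rightarrow> ('a \<Rightarrow> complex) \<Rightarrow> real" where
  "Lq_norm M q f = (\<integral>t. norm (f t) powr q \<partial>M) powr (1 / q)"

text \<open>
  The defining inequality is required only on Muntz polynomials, a dense subspace of
  \<open>M\<^sub>\<Lambda>\<^sup>q\<close>, so the closed span itself does not enter the definition.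
\<close>

definition carleson_measure :: "real measure \<Rightarrow> (nat \<Rightarrow> real) \<Rightarrow> real \<Rightarrow> bool" where
  "carleson_measure \<mu> \<Lambda> q \<longleftrightarrow>
     (\<exists>C. \<forall>f\<in>muntz_polynomials \<Lambda>. Lq_norm \<mu> q f \<le> C * Lq_norm (lebesgue_on {0..1}) q f)"

end

theory Submission
  imports Defs "HOL-Real_Asymp.Real_Asymp"
begin

text \<open>
  Put \<open>t = exp (- s)\<close> and \<open>\<nu> n = \<Lambda> n + 1 / q\<close>. Then the \<open>q\<close>-th power of the \<open>L\<^sup>q\<close> norm of
  \<open>f t = (\<Sum>n. a n * t powr \<Lambda> n)\<close> on \<open>[0,1]\<close> is the integral over \<open>s \<ge> 0\<close> of
  \<open>\<bar>F s\<bar> powr q\<close>, where \<open>F s = (\<Sum>n. a n * exp (- \<nu> n * s))\<close>; the sequence \<open>\<nu>\<close> is still lacunary, and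
  the problem has become invariant under scaling. Both this integral and the one with every
  \<open>a n\<close> replaced by \<open>\<bar>a n\<bar>\<close> are comparable to \<open>\<Sum>n. \<bar>a n\<bar> powr q / \<nu> n\<close> (Gurariy and Macaev).
  So one may assume \<open>a n \<ge> 0\<close>. Then \<open>f\<close> is nondecreasing, and integrals of nondecreasing functions
  against a sublinear measure are controlled by their Lebesgue integrals, as one sees on the
  intervals from \<open>1 - 2^{-k}\<close> to \<open>1 - 2^{-k-1}\<close>.
\<close>

section \<open>Lacunary sequences\<close>

text \<open>The hard direction is the bound of the coefficients by the norm, because
  \<open>r\<close> may be close to 1: a kernel whose Laplace transform peaks at
  \<open>\<nu> n\<close> is then not small at the neighbouring exponents, and diagonal dominance
  fails. The remedy is to give the transform exact zeros at the finitely many exponents within a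
  factor \<open>R\<close> of \<open>\<nu> n\<close>, by Blaschke factors. Their product at
  \<open>\<nu> n\<close> stays above a constant fixed by \<open>r\<close> alone, however large
  \<open>R\<close> is, so \<open>R\<close> can be chosen afterwards to make the remaining exponents
  contribute little. The price is a factor exponential in the number of zeros, which
  \<open>r\<close> and \<open>R\<close> bound. The starting transform \<open>x / (1 + x) ^ 3\<close>
  with \<open>x = l / \<nu> n\<close> decays at both ends even after multiplication by
  \<open>x powr (1 / q)\<close>, a factor produced by normalising the coefficients. The kernels
  vanish linearly at \<open>s = 0\<close>; otherwise the sum over \<open>n\<close> of
  \<open>\<bar>h n s\<bar> / \<nu> n\<close> could not be bounded independently of the number of
  terms. The opposite bound needs only a weighted Jensen inequality.\<close>

lemma sum_power_inj_le:
  fixes \<rho> :: real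
  assumes "0 \<le> \<rho>" "\<rho> < 1" "finite S" "inj_on g S"
  shows "(\<Sum>n\<in>S. \<rho> ^ g n) \<le> 1 / (1 - \<rho>)"
proof -
  have "(\<Sum>n\<in>S. \<rho> ^ g n) = (\<Sum>k\<in>g ` S. \<rho> ^ k)"
    using assms(4) by (simp add: sum.reindex)
  also have "\<dots> \<le> (\<Sum>k. \<rho> ^ k)"
    using assms by (intro sum_le_suminf summable_geometric) auto
  also have "\<dots> = 1 / (1 - \<rho>)"
    using assms by (intro suminf_geometric) auto
  finally show ?thesis .
qed

text \<open>The ratio is a parameter because the later constants have to be uniform over all
  sequences with the same \<open>r\<close>, in particular over the rescalings
  \<open>s * \<nu> n\<close>, which keep the ratio of \<open>\<nu>\<close>.\<close>

definition lacunary_ratio :: "real \<Rightarrow> (nat \<Rightarrow> real) \<Rightarrow> bool" where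
  "lacunary_ratio r y \<longleftrightarrow> 1 < r \<and> (\<forall>n. 0 < y n \<and> r * y n \<le> y (Suc n))"

lemma lacunary_ratioD:
  assumes "lacunary_ratio r y"
  shows "1 < r" "0 < y n" "r * y n \<le> y (Suc n)"
  using assms by (auto simp: lacunary_ratio_def)

lemma lacunary_ratio_scale:
  assumes "lacunary_ratio r y" "0 < c"
  shows "lacunary_ratio r (\<lambda>n. c * y n)"
  using assms by (auto simp: lacunary_ratio_def mult.left_commute[of r c])

lemma lacunary_ratio_power:
  assumes y: "lacunary_ratio r y" and "m \<le> n"
  shows "r ^ (n - m) * y m \<le> y n"
  using \<open>m \<le> n\<close>
proof (induction n rule: dec_induct)
  case (step n)
  have "r ^ (Suc n - m) * y m = r * (r ^ (n - m) * y m)"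
    using step by (simp add: Suc_diff_le)
  also have "\<dots> \<le> r * y n"
    using step lacunary_ratioD[OF y] by (intro mult_left_mono) auto
  also have "\<dots> \<le> y (Suc n)" using lacunary_ratioD(3)[OF y] .
  finally show ?case .
qed simp

text \<open>The terms peak where \<open>y\<close> crosses 1 and decay geometrically with ratio
  \<open>r powr (-\<gamma>)\<close> in both directions, so each side is dominated by one geometric
  series. The bound involves only \<open>r\<close> and \<open>\<gamma>\<close>, hence survives any
  rescaling of \<open>y\<close>.\<close>

lemma lacunary_ratio_min_sum:
  assumes y: "lacunary_ratio r y" and \<gamma>: "0 < \<gamma>" and S: "finite S"
  shows "(\<Sum>n\<in>S. min (y n) (1 / y n) powr \<gamma>) \<le> 2 / (1 - r powr (-\<gamma>))"
proof -
  define \<rho> where "\<rho> = r powr (-\<gamma>)"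
  note yD = lacunary_ratioD[OF y]
  have \<rho>: "0 < \<rho>" "\<rho> < 1"
    using yD(1) \<gamma> by (auto simp: \<rho>_def powr_minus field_simps intro!: gr_one_powr)
  have pow: "\<rho> ^ k = (1 / r ^ k) powr \<gamma>" for k
  proof -
    have "(1 / r ^ k) powr \<gamma> = (r powr (- real k)) powr \<gamma>"
      using yD(1) by (simp add: powr_minus powr_realpow field_simps)
    also have "\<dots> = \<rho> powr (real k)"
      by (simp add: \<rho>_def powr_powr mult.commute)
    finally show ?thesis using \<rho> by (simp add: powr_realpow)
  qed
  define A where "A = {n\<in>S. y n \<le> 1}"
  define B where "B = {n\<in>S. 1 < y n}"
  have fin: "finite A" "finite B" and AB: "S = A \<union> B" "A \<inter> B = {}"
    using S by (auto simp: A_def B_def)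
  have "(\<Sum>n\<in>A. min (y n) (1 / y n) powr \<gamma>) \<le> 1 / (1 - \<rho>)"
  proof (cases "A = {}")
    case False
    \<comment> \<open>Counting down from the last index with \<open>y N \<le> 1\<close>, each term
      is at most \<open>\<rho>\<close> to the power of its distance to \<open>N\<close>; the other
      side counts up from its first index.\<close>
    define N where "N = Max A"
    have N: "N \<in> A" "\<And>n. n \<in> A \<Longrightarrow> n \<le> N"
      using False fin by (auto simp: N_def)
    have "min (y n) (1 / y n) powr \<gamma> \<le> \<rho> ^ (N - n)" if "n \<in> A" for n
    proof -
      have "r ^ (N - n) * y n \<le> y N" using lacunary_ratio_power[OF y] N that by auto
      also have "\<dots> \<le> 1" using N by (auto simp: A_def)
      finally have "y n \<le> 1 / r ^ (N - n)" using yD(1) by (simp add: field_simps)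
      then show ?thesis unfolding pow using yD(2)[of n] \<gamma> by (intro powr_mono2) auto
    qed
    then have "(\<Sum>n\<in>A. min (y n) (1 / y n) powr \<gamma>) \<le> (\<Sum>n\<in>A. \<rho> ^ (N - n))"
      by (rule sum_mono)
    also have "\<dots> \<le> 1 / (1 - \<rho>)"
    proof (rule sum_power_inj_le)
      show "inj_on (\<lambda>n. N - n) A" using N(2) by (intro inj_onI) (metis diff_diff_cancel)
    qed (use \<rho> fin in auto)
    finally show ?thesis .
  qed (use \<rho> in auto)
  moreover have "(\<Sum>n\<in>B. min (y n) (1 / y n) powr \<gamma>) \<le> 1 / (1 - \<rho>)"
  proof (cases "B = {}")
    case False
    define N where "N = Min B"
    have N: "N \<in> B" "\<And>n. n \<in> B \<Longrightarrow> N \<le> n"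
      using False fin by (auto simp: N_def)
    have "min (y n) (1 / y n) powr \<gamma> \<le> \<rho> ^ (n - N)" if "n \<in> B" for n
    proof -
      have "r ^ (n - N) * 1 \<le> r ^ (n - N) * y N"
        using N yD(1) by (intro mult_left_mono) (auto simp: B_def)
      also have "\<dots> \<le> y n" using lacunary_ratio_power[OF y] N that by auto
      finally have "1 / y n \<le> 1 / r ^ (n - N)" using yD(1) yD(2)[of n] by (intro divide_left_mono) auto
      then show ?thesis unfolding pow using yD(2)[of n] \<gamma> by (intro powr_mono2) auto
    qed
    then have "(\<Sum>n\<in>B. min (y n) (1 / y n) powr \<gamma>) \<le> (\<Sum>n\<in>B. \<rho> ^ (n - N))"
      by (rule sum_mono)
    also have "\<dots> \<le> 1 / (1 - \<rho>)"
    proof (rule sum_power_inj_le)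
      show "inj_on (\<lambda>n. n - N) B" using N(2) by (intro inj_onI) (metis le_add_diff_inverse)
    qed (use \<rho> fin in auto)
    finally show ?thesis .
  qed (use \<rho> in auto)
  ultimately show ?thesis
    using AB fin by (simp add: sum.union_disjoint \<rho>_def)
qed

text \<open>The right-hand side is the maximum of the left-hand side, attained at
  \<open>y = a / c\<close>; it comes from \<open>ln z \<le> z - 1\<close> with
  \<open>z = c * y / a\<close>.\<close>

lemma powr_times_exp_le:
  fixes a c y :: real
  assumes "0 < a" "0 < c" "0 < y"
  shows "y powr a * exp (- c * y) \<le> exp (- a * (1 + ln (c / a)))"
proof -
  have "ln (c * y / a) \<le> c * y / a - 1"
    using assms by (intro ln_le_minus_one) auto
  moreover have "ln (c * y / a) = ln (c / a) + ln y"
    using assms by (simp add: ln_mult ln_div)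
  ultimately have "a * ln y \<le> a * (c * y / a - 1 - ln (c / a))"
    using assms by (intro mult_left_mono) auto
  also have "\<dots> = c * y - a * (1 + ln (c / a))"
    using assms by (simp add: field_simps)
  finally show ?thesis
    using assms by (simp add: powr_def flip: exp_add)
qed

lemma powr_exp_le_min:
  fixes c \<gamma> :: real
  assumes "0 < \<gamma>" "0 < c"
  obtains K where "0 < K" "\<And>y. 0 < y \<Longrightarrow> y powr \<gamma> * exp (- c * y) \<le> K * min y (1 / y) powr \<gamma>"
proof
  \<comment> \<open>The 1 serves \<open>y \<le> 1\<close>, where the exponential is at most 1. For
    \<open>y > 1\<close> the claim says that \<open>y powr (2 * \<gamma>) * exp (- c * y)\<close> is
    bounded, and the second entry is its maximum.\<close>
  define K where "K = max 1 (exp (- (2 * \<gamma>) * (1 + ln (c / (2 * \<gamma>)))))"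
  show "0 < K" by (simp add: K_def)
  fix y :: real assume y: "0 < y"
  show "y powr \<gamma> * exp (- c * y) \<le> K * min y (1 / y) powr \<gamma>"
  proof (cases "y \<le> 1")
    case True
    then have "min y (1 / y) = y" using y by (simp add: min_def field_simps)
        (meson mult_mono order.trans less_imp_le linorder_not_le mult_less_cancel_right2 mult_le_one)
    moreover have "exp (- c * y) \<le> K" using assms y by (simp add: K_def le_max_iff_disj)
    ultimately show ?thesis
      using mult_right_mono[of "exp (- c * y)" K "y powr \<gamma>"] by (simp add: mult.commute)
  next
    case False
    have "y powr (2 * \<gamma>) * exp (- c * y) \<le> K"
      using powr_times_exp_le[of "2 * \<gamma>" c y] assms y by (simp add: K_def le_max_iff_disj)
    then have "y powr \<gamma> * exp (- c * y) \<le> K / y powr \<gamma>"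
      using y powr_add[of y \<gamma> \<gamma>] by (simp add: field_simps)
    moreover have "min y (1 / y) = 1 / y" using False y by (simp add: min_def field_simps)
        (meson less_1_mult linorder_not_le less_imp_le order.strict_trans1)
    ultimately show ?thesis using y by (simp add: powr_divide)
  qed
qed

text \<open>A discrete, scale-invariant analogue of the Gamma integral. It is applied to
  \<open>y n = s * \<nu> n\<close>, where it gives a bound uniform in \<open>s > 0\<close>.\<close>

lemma lacunary_ratio_exp_sum:
  fixes c \<gamma> r :: real
  assumes "0 < \<gamma>" "0 < c" "1 < r"
  obtains C where "0 < C"
    "\<And>y S. lacunary_ratio r y \<Longrightarrow> finite S \<Longrightarrow> (\<Sum>n\<in>S. y n powr \<gamma> * exp (- c * y n)) \<le> C"
proof -
  obtain K where K: "0 < K"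
    "\<And>y. 0 < y \<Longrightarrow> y powr \<gamma> * exp (- c * y) \<le> K * min y (1 / y) powr \<gamma>"
    using powr_exp_le_min[OF assms(1,2)] by blast
  have "r powr (-\<gamma>) < 1"
    using assms by (auto simp: powr_minus field_simps intro!: gr_one_powr)
  show ?thesis
  proof (rule that[of "K * (2 / (1 - r powr (-\<gamma>)))"])
    show "0 < K * (2 / (1 - r powr (-\<gamma>)))" using K \<open>r powr (-\<gamma>) < 1\<close> by simp
  next
    fix y :: "nat \<Rightarrow> real" and S :: "nat set"
    assume y: "lacunary_ratio r y" and S: "finite S"
    have "(\<Sum>n\<in>S. y n powr \<gamma> * exp (- c * y n)) \<le> (\<Sum>n\<in>S. K * min (y n) (1 / y n) powr \<gamma>)"
      using K lacunary_ratioD(2)[OF y] by (intro sum_mono) auto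
    also have "\<dots> = K * (\<Sum>n\<in>S. min (y n) (1 / y n) powr \<gamma>)"
      by (simp add: sum_distrib_left)
    also have "\<dots> \<le> K * (2 / (1 - r powr (-\<gamma>)))"
      using K(1) lacunary_ratio_min_sum[OF y assms(1) S] by (intro mult_left_mono) auto
    finally show "(\<Sum>n\<in>S. y n powr \<gamma> * exp (- c * y n)) \<le> K * (2 / (1 - r powr (-\<gamma>)))" .
  qed
qed

text \<open>With \<open>z = 2 * y / (1 - y)\<close> the reciprocal factor is
  \<open>1 + z \<le> exp z\<close>, and \<open>y \<le> 1 / r\<close> keeps \<open>1 - y\<close> away
  from 0, which makes the exponent linear in \<open>y\<close>.\<close>

lemma Blaschke_factor_ge:
  fixes y r :: real
  assumes "1 < r" "0 \<le> y" "y \<le> 1 / r"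
  shows "exp (- (2 * r / (r - 1)) * y) \<le> (1 - y) / (1 + y)"
proof -
  have y: "y < 1" using assms by (smt (verit) divide_less_eq_1)
  have "2 * y / (1 - y) \<le> 2 * y / (1 - 1 / r)"
    using assms y by (intro divide_left_mono mult_pos_pos) auto
  also have "\<dots> = 2 * r / (r - 1) * y" using assms by (simp add: field_simps)
  finally have "exp (2 * y / (1 - y)) \<le> exp (2 * r / (r - 1) * y)" by simp
  moreover have "(1 + y) / (1 - y) = 1 + 2 * y / (1 - y)" using y by (simp add: field_simps)
  then have "(1 + y) / (1 - y) \<le> exp (2 * y / (1 - y))"
    using exp_ge_add_one_self by metis
  ultimately have "(1 + y) / (1 - y) \<le> exp (2 * r / (r - 1) * y)" by linarith
  then have "inverse (exp (2 * r / (r - 1) * y)) \<le> inverse ((1 + y) / (1 - y))"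
    using assms y by (intro le_imp_inverse_le) auto
  then show ?thesis by (simp add: exp_minus)
qed

text \<open>Each factor is \<open>(1 - y m) / (1 + y m)\<close> for a \<open>y m \<le> 1 / r\<close>
  whose sum over \<open>m\<close> is bounded by lacunarity, so the exponential lower bounds multiply
  up. The bound does not depend on \<open>W\<close> or \<open>n\<close>: arbitrarily many zeros can
  be imposed without losing the value at \<open>\<nu> n\<close>.\<close>

lemma Blaschke_product_ge:
  assumes \<nu>: "lacunary_ratio r \<nu>" and W: "finite W" "n \<notin> W"
  shows "exp (- (2 * r / (r - 1)) * (2 / (1 - 1 / r))) \<le> (\<Prod>m\<in>W. \<bar>(\<nu> m - \<nu> n) / (\<nu> m + \<nu> n)\<bar>)"
proof -
  note \<nu>D = lacunary_ratioD[OF \<nu>]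
  define x where "x m = (1 / \<nu> n) * \<nu> m" for m
  define y where "y m = min (x m) (1 / x m)" for m
  have x: "lacunary_ratio r x"
    unfolding x_def using \<nu> \<nu>D(2) by (intro lacunary_ratio_scale) auto
  have "(\<Sum>m\<in>W. y m powr 1) \<le> 2 / (1 - r powr (-1))"
    unfolding y_def by (rule lacunary_ratio_min_sum[OF x _ W(1)]) simp
  moreover have y0: "0 < y m" for m using lacunary_ratioD(2)[OF x, of m] by (simp add: y_def)
  ultimately have "(\<Sum>m\<in>W. y m) \<le> 2 / (1 - 1 / r)"
    using \<nu>D(1) by (simp add: powr_minus field_simps less_imp_le)
  then have "exp (- (2 * r / (r - 1)) * (2 / (1 - 1 / r))) \<le> exp (- (2 * r / (r - 1)) * (\<Sum>m\<in>W. y m))"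
    using \<nu>D(1) by (subst exp_le_cancel_iff, intro mult_left_mono_neg) auto
  also have "\<dots> = (\<Prod>m\<in>W. exp (- (2 * r / (r - 1)) * y m))"
    using W(1) by (simp add: sum_distrib_left exp_sum flip: sum_negf)
  also have "\<dots> \<le> (\<Prod>m\<in>W. \<bar>(\<nu> m - \<nu> n) / (\<nu> m + \<nu> n)\<bar>)"
  proof (rule prod_mono)
    fix m assume "m \<in> W"
    then have mn: "m \<noteq> n" using W by auto
    have pos: "0 < \<nu> m" "0 < \<nu> n" using \<nu>D by auto
    have gap: "r * \<nu> i \<le> \<nu> j" if "i < j" for i j
    proof -
      have "r * \<nu> i \<le> r ^ (j - i) * \<nu> i"
        using that \<nu>D(1) \<nu>D(2)[of i] by (intro mult_right_mono self_le_power) auto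
      also have "\<dots> \<le> \<nu> j" using that by (intro lacunary_ratio_power[OF \<nu>]) auto
      finally show ?thesis .
    qed
    have quot: "(1 - a / b) / (1 + a / b) = (b - a) / (b + a)" if "0 < a" "0 < b" for a b :: real
      using that by (simp add: divide_simps)
    \<comment> \<open>\<open>y m\<close> is the quotient of the smaller exponent by the larger, so
      both orders of \<open>m\<close> and \<open>n\<close> give the same factor up to a sign, which
      the absolute value removes.\<close>
    have "y m \<le> 1 / r \<and> (1 - y m) / (1 + y m) \<le> \<bar>(\<nu> m - \<nu> n) / (\<nu> m + \<nu> n)\<bar>"
    proof (cases "m < n")
      case True
      have "1 * \<nu> m < r * \<nu> m" using \<nu>D(1) pos by (intro mult_strict_right_mono) auto
      then have lt: "\<nu> m < \<nu> n" using gap[OF True] by simp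
      then have "\<nu> m * \<nu> m \<le> \<nu> n * \<nu> n" using pos by (intro mult_mono) auto
      then have ym: "y m = \<nu> m / \<nu> n" using pos by (simp add: y_def x_def min_def field_simps)
      show ?thesis using gap[OF True] lt pos \<nu>D(1) unfolding ym
        by (subst quot) (auto simp: abs_if field_simps)
    next
      case False
      then have nm: "n < m" using mn by auto
      have "1 * \<nu> n < r * \<nu> n" using \<nu>D(1) pos by (intro mult_strict_right_mono) auto
      then have lt: "\<nu> n < \<nu> m" using gap[OF nm] by simp
      then have "\<nu> n * \<nu> n < \<nu> m * \<nu> m" using pos by (intro mult_strict_mono) auto
      then have ym: "y m = \<nu> n / \<nu> m" using pos by (simp add: y_def x_def min_def field_simps)
      show ?thesis using gap[OF nm] lt pos \<nu>D(1) unfolding ym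
        by (subst quot) (auto simp: abs_if field_simps)
    qed
    then show "0 \<le> exp (- (2 * r / (r - 1)) * y m) \<and>
        exp (- (2 * r / (r - 1)) * y m) \<le> \<bar>(\<nu> m - \<nu> n) / (\<nu> m + \<nu> n)\<bar>"
      using Blaschke_factor_ge[of r "y m"] \<nu>D(1) y0[of m] by auto
  qed
  finally show ?thesis .
qed

section \<open>Kernels with prescribed zeros of the Laplace transform\<close>

lemma exp_integral_Ici:
  fixes \<kappa> :: real
  assumes "0 < \<kappa>"
  shows "integrable (lebesgue_on {0..}) (\<lambda>s. exp (- \<kappa> * s))"
    and "integral\<^sup>L (lebesgue_on {0..}) (\<lambda>s. exp (- \<kappa> * s)) = 1 / \<kappa>"
proof -
  have hk: "((\<lambda>s. exp (- \<kappa> * s)) has_integral 1 / \<kappa>) {0..}"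
    using has_integral_exp_minus_to_infinity[OF assms, of 0] by simp
  then have "(\<lambda>s. exp (- \<kappa> * s)) absolutely_integrable_on {0..}"
    by (intro nonnegative_absolutely_integrable_1) auto
  then show int: "integrable (lebesgue_on {0..}) (\<lambda>s. exp (- \<kappa> * s))"
    by (rule absolutely_integrable_imp_integrable) simp
  then show "integral\<^sup>L (lebesgue_on {0..}) (\<lambda>s. exp (- \<kappa> * s)) = 1 / \<kappa>"
    using hk by (simp add: lebesgue_integral_eq_integral integral_unique)
qed

lemma integrable_Ici_exp_bound:
  fixes f :: "real \<Rightarrow> 'a::euclidean_space"
  assumes "continuous_on {0..} f" "0 < \<kappa>" "\<And>s. 0 \<le> s \<Longrightarrow> norm (f s) \<le> D * exp (- \<kappa> * s)"
  shows "integrable (lebesgue_on {0..}) f"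
proof (rule Bochner_Integration.integrable_bound)
  show "integrable (lebesgue_on {0..}) (\<lambda>s. D * exp (- \<kappa> * s))"
    using exp_integral_Ici(1)[OF assms(2)] by simp
  show "f \<in> borel_measurable (lebesgue_on {0..})"
    using assms(1) by (intro continuous_imp_measurable_on_sets_lebesgue) auto
  show "AE s in lebesgue_on {0..}. norm (f s) \<le> norm (D * exp (- \<kappa> * s))"
  proof (rule AE_I2)
    fix s assume "s \<in> space (lebesgue_on {0::real..})"
    then have "norm (f s) \<le> D * exp (- \<kappa> * s)" using assms(3) by auto
    then show "norm (f s) \<le> norm (D * exp (- \<kappa> * s))" by simp
  qed
qed

text \<open>Half of the decay rate is spent on absorbing the factor \<open>s\<close>. This loss
  produces the 4 in \<open>mult_exp_integral_Ici\<close>, where the exact value is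
  \<open>1 / \<kappa>\<^sup>2\<close>.\<close>

lemma mult_exp_le_exp:
  fixes \<kappa> s :: real
  assumes "0 < \<kappa>"
  shows "s * exp (- \<kappa> * s) \<le> 2 / \<kappa> * exp (- (\<kappa> / 2) * s)"
proof -
  have "\<kappa> / 2 * s \<le> exp (\<kappa> / 2 * s)"
    using exp_ge_add_one_self[of "\<kappa> / 2 * s"] by linarith
  then have "s \<le> 2 / \<kappa> * exp (\<kappa> / 2 * s)"
    using assms by (simp add: field_simps)
  then have "s * exp (- \<kappa> * s) \<le> 2 / \<kappa> * exp (\<kappa> / 2 * s) * exp (- \<kappa> * s)"
    by (intro mult_right_mono) auto
  then show ?thesis by (simp add: field_simps flip: exp_add)
qed

lemma integrable_Ici_mult_exp_bound:
  fixes f :: "real \<Rightarrow> 'a::euclidean_space"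
  assumes "continuous_on {0..} f" "0 < \<kappa>" "\<And>s. 0 \<le> s \<Longrightarrow> norm (f s) \<le> D * (s * exp (- \<kappa> * s))"
  shows "integrable (lebesgue_on {0..}) f"
proof (rule integrable_Ici_exp_bound[OF assms(1)])
  have "0 \<le> D"
    using order_trans[OF norm_ge_zero assms(3)[of 1]] by (simp add: zero_le_mult_iff)
  then show "norm (f s) \<le> D * (2 / \<kappa>) * exp (- (\<kappa> / 2) * s)" if "0 \<le> s" for s
    using order_trans[OF assms(3)[OF that] mult_left_mono[OF mult_exp_le_exp[OF assms(2)]]]
    by (simp add: mult.assoc)
qed (use assms(2) in simp)

lemma mult_exp_integral_Ici:
  fixes \<kappa> :: real
  assumes "0 < \<kappa>"
  shows "integrable (lebesgue_on {0..}) (\<lambda>s. s * exp (- \<kappa> * s))"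
    and "integral\<^sup>L (lebesgue_on {0..}) (\<lambda>s. s * exp (- \<kappa> * s)) \<le> 4 / \<kappa>\<^sup>2"
proof -
  show int: "integrable (lebesgue_on {0..}) (\<lambda>s. s * exp (- \<kappa> * s))"
    by (rule integrable_Ici_mult_exp_bound[OF _ assms, where D = 1]) (auto intro!: continuous_intros)
  have half: "0 < \<kappa> / 2" using assms by simp
  have "integral\<^sup>L (lebesgue_on {0..}) (\<lambda>s. s * exp (- \<kappa> * s))
      \<le> integral\<^sup>L (lebesgue_on {0..}) (\<lambda>s. 2 / \<kappa> * exp (- (\<kappa> / 2) * s))"
    using mult_exp_le_exp[OF assms] exp_integral_Ici(1)[OF half]
    by (intro integral_mono int) auto
  also have "\<dots> = 4 / \<kappa>\<^sup>2"
    using exp_integral_Ici(2)[OF half] by (simp add: power2_eq_square)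
  finally show "integral\<^sup>L (lebesgue_on {0..}) (\<lambda>s. s * exp (- \<kappa> * s)) \<le> 4 / \<kappa>\<^sup>2" .
qed

text \<open>The fundamental theorem on \<open>{0..real n}\<close>, followed by dominated
  convergence. It computes the Laplace transforms below from antiderivatives that decay at
  infinity.\<close>

lemma FTC_Ici:
  fixes f F :: "real \<Rightarrow> real"
  assumes cont: "continuous_on {0..} F"
    and deriv: "\<And>s. 0 < s \<Longrightarrow> (F has_real_derivative f s) (at s)"
    and int: "integrable (lebesgue_on {0..}) f"
    and lim: "(F \<longlongrightarrow> 0) at_top"
  shows "integral\<^sup>L (lebesgue_on {0..}) f = - F 0"
proof -
  have "(f has_integral (0 - F 0)) {0..}"
  proof (rule has_integral_dominated_convergence)
    fix n :: nat
    have "(f has_integral (F (real n) - F 0)) {0..real n}"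
      using deriv by (intro fundamental_theorem_of_calculus_interior continuous_on_subset[OF cont])
        (auto simp: has_real_derivative_iff_has_vector_derivative)
    then show "((\<lambda>s. if s \<in> {0..real n} then f s else 0) has_integral (F (real n) - F 0)) {0..}"
      by (subst has_integral_restrict) auto
  next
    show "(\<lambda>s. norm (f s)) integrable_on {0..}"
      using integrable_norm[OF int] by (intro integrable_on_lebesgue_on) auto
    show "\<forall>s\<in>{0..}. (\<lambda>n. if s \<in> {0..real n} then f s else 0) \<longlonglongrightarrow> f s"
    proof
      fix s :: real assume "s \<in> {0..}"
      obtain N :: nat where "s \<le> real N" using real_arch_simple by blast
      then have "\<forall>\<^sub>F n in sequentially. (if s \<in> {0..real n} then f s else 0) = f s"
        using \<open>s \<in> {0..}\<close> by (intro eventually_sequentiallyI[of N]) auto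
      then show "(\<lambda>n. if s \<in> {0..real n} then f s else 0) \<longlonglongrightarrow> f s"
        by (rule tendsto_eventually)
    qed
    show "(\<lambda>n. F (real n) - F 0) \<longlonglongrightarrow> 0 - F 0"
      by (intro tendsto_intros filterlim_compose[OF lim] filterlim_real_sequentially)
  qed auto
  then show ?thesis
    using lebesgue_integral_eq_integral[OF int] by (simp add: integral_unique)
qed

section \<open>Laplace transforms and multiplication by Blaschke factors\<close>

lemma exp_mult_const_tendsto_0:
  fixes \<kappa> D :: real
  assumes "0 < \<kappa>"
  shows "((\<lambda>s. D * (s * exp (- \<kappa> * s))) \<longlongrightarrow> 0) at_top"
  using assms by real_asymp

lemma Laplace_integrable:
  fixes h :: "real \<Rightarrow> real"
  assumes "continuous_on {0..} h" "0 < \<kappa>" "\<And>s. 0 \<le> s \<Longrightarrow> \<bar>h s\<bar> \<le> D * (s * exp (- \<kappa> * s))" "0 \<le> l"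
  shows "integrable (lebesgue_on {0..}) (\<lambda>s. exp (- l * s) * h s)"
proof (rule integrable_Ici_mult_exp_bound[OF _ assms(2), where D = D])
  show "norm (exp (- l * s) * h s) \<le> D * (s * exp (- \<kappa> * s))" if "0 \<le> s" for s
  proof -
    have "exp (- l * s) * \<bar>h s\<bar> \<le> 1 * \<bar>h s\<bar>"
      using that assms(4) by (intro mult_right_mono) auto
    then show ?thesis using assms(3)[OF that] by (simp add: abs_mult)
  qed
qed (auto intro!: continuous_intros assms(1))

text \<open>Convolving with \<open>2 b exp (- b s)\<close> and subtracting the identity multiplies the Laplace
  transform by the Blaschke factor \<open>(b - l) / (b + l)\<close>.\<close>

lemma Blaschke_step:
  fixes h :: "real \<Rightarrow> real" and b \<kappa> D :: real
  assumes h: "continuous_on {0..} h" and \<kappa>: "0 < \<kappa>" "2 * \<kappa> \<le> b"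
    and bound: "\<And>s. 0 \<le> s \<Longrightarrow> \<bar>h s\<bar> \<le> D * (s * exp (- \<kappa> * s))"
  obtains k where "continuous_on {0..} k"
    "\<And>s. 0 \<le> s \<Longrightarrow> \<bar>k s\<bar> \<le> 5 * D * (s * exp (- \<kappa> * s))"
    "\<And>l. 0 < l \<Longrightarrow> integral\<^sup>L (lebesgue_on {0..}) (\<lambda>s. exp (- l * s) * k s)
      = (b - l) / (b + l) * integral\<^sup>L (lebesgue_on {0..}) (\<lambda>s. exp (- l * s) * h s)"
proof -
  \<comment> \<open>\<open>y\<close> is the convolution of \<open>h\<close> with
    \<open>exp (- b * s)\<close>, written so that it visibly solves \<open>y' = h - b * y\<close>
    with \<open>y 0 = 0\<close>.\<close>
  define H where "H s = integral {0..s} (\<lambda>u. exp (b * u) * h u)" for s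
  define y where "y s = exp (- b * s) * H s" for s
  have cont_eh: "continuous_on {0..s} (\<lambda>u. exp (b * u) * h u)" for s
    by (intro continuous_intros continuous_on_subset[OF h]) auto
  have H_deriv: "(H has_real_derivative exp (b * s) * h s) (at s)" if "0 < s" for s
  proof -
    have "(H has_real_derivative exp (b * s) * h s) (at s within {0..s + 1})"
      unfolding H_def using that by (intro integral_has_real_derivative cont_eh) auto
    moreover have "at s within {0..s + 1} = at s"
      using that by (intro at_within_interior) (simp add: interior_atLeastAtMost_real)
    ultimately show ?thesis by simp
  qed
  have H_cont: "continuous_on {0..} H"
    unfolding continuous_on_eq_continuous_within
  proof
    fix s :: real assume s: "s \<in> {0..}"
    have "continuous_on {0..s + 1} H"
      unfolding H_def by (intro indefinite_integral_continuous_1 integrable_continuous_interval cont_eh)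
    then have "continuous (at s within {0..s + 1}) H"
      using s by (auto simp: continuous_on_eq_continuous_within)
    moreover have "at s within {0..s + 1} = at s within {0..}"
      using s by (intro at_within_nhd[of _ "{..<s + 1}"]) auto
    ultimately show "continuous (at s within {0..}) H"
      by (simp add: continuous_within)
  qed
  have D: "0 \<le> D"
    using order_trans[OF abs_ge_zero bound[of 1]] by (simp add: zero_le_mult_iff)
  have b: "0 < b" "0 < b - \<kappa>" using \<kappa> by auto
  have H_bound: "\<bar>H s\<bar> \<le> D * s * (exp ((b - \<kappa>) * s) / (b - \<kappa>))" if s: "0 \<le> s" for s
  proof -
    have e: "((\<lambda>u. exp ((b - \<kappa>) * u)) has_integral
        exp ((b - \<kappa>) * s) / (b - \<kappa>) - exp ((b - \<kappa>) * 0) / (b - \<kappa>)) {0..s}"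
      using s b by (intro fundamental_theorem_of_calculus)
        (auto intro!: derivative_eq_intros simp flip: has_real_derivative_iff_has_vector_derivative)
    have "norm (H s) \<le> integral {0..s} (\<lambda>u. D * s * exp ((b - \<kappa>) * u))"
      unfolding H_def
    proof (rule integral_norm_bound_integral)
      show "(\<lambda>u. exp (b * u) * h u) integrable_on {0..s}"
        by (intro integrable_continuous_interval cont_eh)
      show "(\<lambda>u. D * s * exp ((b - \<kappa>) * u)) integrable_on {0..s}"
        using e by (intro integrable_on_mult_right) auto
      fix u assume u: "u \<in> {0..s}"
      have "norm (exp (b * u) * h u) \<le> exp (b * u) * (D * (u * exp (- \<kappa> * u)))"
        using bound[of u] u by (simp add: abs_mult)
      \<comment> \<open>Replacing \<open>u\<close> by \<open>s\<close> keeps a factor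
        \<open>s\<close> outside the integral, so the convolution again vanishes linearly at
        0.\<close>
      also have "\<dots> \<le> exp (b * u) * (D * (s * exp (- \<kappa> * u)))"
        using u D by (intro mult_left_mono mult_right_mono) auto
      also have "\<dots> = D * s * exp ((b - \<kappa>) * u)"
        by (simp add: left_diff_distrib exp_diff exp_minus field_simps)
      finally show "norm (exp (b * u) * h u) \<le> D * s * exp ((b - \<kappa>) * u)" .
    qed
    also have "\<dots> = D * s * (exp ((b - \<kappa>) * s) / (b - \<kappa>) - 1 / (b - \<kappa>))"
      using integral_unique[OF e] by simp
    also have "\<dots> \<le> D * s * (exp ((b - \<kappa>) * s) / (b - \<kappa>))"
      using D s b by (intro mult_left_mono) auto
    finally show ?thesis by simp
  qed
  have y_cont: "continuous_on {0..} y"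
    unfolding y_def by (intro continuous_intros H_cont)
  have y_bound: "\<bar>y s\<bar> \<le> D / (b - \<kappa>) * (s * exp (- \<kappa> * s))" if "0 \<le> s" for s
  proof -
    have "\<bar>y s\<bar> \<le> exp (- b * s) * (D * s * (exp ((b - \<kappa>) * s) / (b - \<kappa>)))"
      using mult_left_mono[OF H_bound[OF that], of "exp (- b * s)"] by (simp add: y_def abs_mult)
    also have "\<dots> = D / (b - \<kappa>) * (s * exp (- \<kappa> * s))"
      by (simp add: left_diff_distrib exp_diff exp_minus field_simps)
    finally show ?thesis .
  qed
  have y_deriv: "(y has_real_derivative h s - b * y s) (at s)" if "0 < s" for s
    unfolding y_def
    by (auto intro!: derivative_eq_intros H_deriv that simp: algebra_simps exp_minus)
  note int_y = Laplace_integrable[OF y_cont \<kappa>(1) y_bound]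
  note int_h = Laplace_integrable[OF h \<kappa>(1) bound]
  have L: "integral\<^sup>L (lebesgue_on {0..}) (\<lambda>s. exp (- l * s) * h s)
      = (b + l) * integral\<^sup>L (lebesgue_on {0..}) (\<lambda>s. exp (- l * s) * y s)" if l: "0 < l" for l
  proof -
    \<comment> \<open>The integrand is the derivative of \<open>exp (- l * s) * y s\<close>, which
      vanishes at 0 and at infinity; hence the transform of \<open>y\<close> is that of
      \<open>h\<close> divided by \<open>b + l\<close>.\<close>
    have "integral\<^sup>L (lebesgue_on {0..}) (\<lambda>s. exp (- l * s) * h s - (b + l) * (exp (- l * s) * y s))
        = - (exp (- l * 0) * y 0)"
    proof (rule FTC_Ici)
      show "continuous_on {0..} (\<lambda>s. exp (- l * s) * y s)"
        by (intro continuous_intros y_cont)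
      show "((\<lambda>s. exp (- l * s) * y s) has_real_derivative
          exp (- l * s) * h s - (b + l) * (exp (- l * s) * y s)) (at s)" if "0 < s" for s
        by (auto intro!: derivative_eq_intros y_deriv that simp: algebra_simps)
      show "integrable (lebesgue_on {0..}) (\<lambda>s. exp (- l * s) * h s - (b + l) * (exp (- l * s) * y s))"
        using l by (intro Bochner_Integration.integrable_diff integrable_mult_right int_y int_h) auto
      show "((\<lambda>s. exp (- l * s) * y s) \<longlongrightarrow> 0) at_top"
      proof (rule Lim_null_comparison)
        show "((\<lambda>s. D / (b - \<kappa>) * (s * exp (- \<kappa> * s))) \<longlongrightarrow> 0) at_top"
          by (rule exp_mult_const_tendsto_0[OF \<kappa>(1)])
        have "norm (exp (- l * s) * y s) \<le> D / (b - \<kappa>) * (s * exp (- \<kappa> * s))" if s: "0 \<le> s" for s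
        proof -
          have "exp (- l * s) * \<bar>y s\<bar> \<le> 1 * \<bar>y s\<bar>"
            using s l by (intro mult_right_mono) auto
          then show ?thesis using y_bound[OF s] by (simp add: abs_mult)
        qed
        then show "\<forall>\<^sub>F s in at_top. norm (exp (- l * s) * y s) \<le> D / (b - \<kappa>) * (s * exp (- \<kappa> * s))"
          using eventually_ge_at_top[of 0] by (rule eventually_mono[rotated])
      qed
    qed
    moreover have "y 0 = 0" by (simp add: y_def H_def)
    ultimately show ?thesis
      using l int_y[of l] int_h[of l] by (subst (asm) Bochner_Integration.integral_diff) auto
  qed
  show ?thesis
  proof (rule that[of "\<lambda>s. 2 * b * y s - h s"])
    show "continuous_on {0..} (\<lambda>s. 2 * b * y s - h s)"
      by (intro continuous_intros y_cont h)
    show "\<bar>2 * b * y s - h s\<bar> \<le> 5 * D * (s * exp (- \<kappa> * s))" if s: "0 \<le> s" for s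
    proof -
      \<comment> \<open>From \<open>2 * \<kappa> \<le> b\<close>. The convolution thus costs a
        factor 4 and the subtracted \<open>h\<close> another 1, which makes the 5; the decay rate is
        unchanged.\<close>
      have "2 * b / (b - \<kappa>) \<le> 4" using b \<kappa> by (simp add: field_simps)
      then have "2 * b / (b - \<kappa>) * (D * (s * exp (- \<kappa> * s))) \<le> 4 * (D * (s * exp (- \<kappa> * s)))"
        using D s by (intro mult_right_mono) auto
      moreover have "2 * b * \<bar>y s\<bar> \<le> 2 * b * (D / (b - \<kappa>) * (s * exp (- \<kappa> * s)))"
        using y_bound[OF s] b by (intro mult_left_mono) auto
      moreover have "\<bar>2 * b * y s - h s\<bar> \<le> 2 * b * \<bar>y s\<bar> + \<bar>h s\<bar>"
        using b abs_triangle_ineq4[of "2 * b * y s" "h s"] by (simp add: abs_mult)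
      ultimately show ?thesis using bound[OF s] by simp
    qed
    show "integral\<^sup>L (lebesgue_on {0..}) (\<lambda>s. exp (- l * s) * (2 * b * y s - h s))
      = (b - l) / (b + l) * integral\<^sup>L (lebesgue_on {0..}) (\<lambda>s. exp (- l * s) * h s)" if l: "0 < l" for l
    proof -
      have "integral\<^sup>L (lebesgue_on {0..}) (\<lambda>s. exp (- l * s) * (2 * b * y s - h s))
        = integral\<^sup>L (lebesgue_on {0..}) (\<lambda>s. 2 * b * (exp (- l * s) * y s) - exp (- l * s) * h s)"
        by (intro Bochner_Integration.integral_cong) (auto simp: algebra_simps)
      also have "\<dots> = 2 * b * integral\<^sup>L (lebesgue_on {0..}) (\<lambda>s. exp (- l * s) * y s)
          - integral\<^sup>L (lebesgue_on {0..}) (\<lambda>s. exp (- l * s) * h s)"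
        using l int_y[of l] int_h[of l] by (subst Bochner_Integration.integral_diff) auto
      moreover have "(b - l) / (b + l) * ((b + l) * Y) = 2 * b * Y - (b + l) * Y" for Y
      proof -
        have "b + l \<noteq> 0" using l b by simp
        then have "(b - l) / (b + l) * ((b + l) * Y) = (b - l) * Y" by simp
        then show ?thesis by (simp add: algebra_simps)
      qed
      ultimately show ?thesis by (simp only: L[OF l])
    qed
  qed
qed

text \<open>\<open>h\<close> is the difference of the kernels with transforms
  \<open>\<nu>\<^sup>2 / (l + \<nu>)\<^sup>2\<close> and \<open>\<nu> ^ 3 / (l + \<nu>) ^ 3\<close>,
  which agree at \<open>l = 0\<close>. The resulting transform depends on
  \<open>x = l / \<nu>\<close> only, and behaves like \<open>x\<close> near 0 and like
  \<open>1 / x\<^sup>2\<close> at infinity.\<close>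

lemma base_kernel:
  fixes \<nu> \<kappa> :: real
  defines "h \<equiv> \<lambda>s. \<nu>\<^sup>2 * ((s - \<nu> * s\<^sup>2 / 2) * exp (- \<nu> * s))"
  assumes \<kappa>: "0 < \<kappa>" "2 * \<kappa> \<le> \<nu>"
  shows "\<And>s. 0 \<le> s \<Longrightarrow> \<bar>h s\<bar> \<le> \<nu>\<^sup>2 * (s * exp (- \<kappa> * s))"
    and "\<And>l. 0 < l \<Longrightarrow> integral\<^sup>L (lebesgue_on {0..}) (\<lambda>s. exp (- l * s) * h s)
      = (l / \<nu>) / (1 + l / \<nu>) ^ 3"
proof -
  show bound: "\<bar>h s\<bar> \<le> \<nu>\<^sup>2 * (s * exp (- \<kappa> * s))" if s: "0 \<le> s" for s
  proof -
    have \<nu>: "0 < \<nu>" using \<kappa> by simp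
    have "\<bar>s - \<nu> * s\<^sup>2 / 2\<bar> \<le> \<bar>s\<bar> + \<bar>\<nu> * s\<^sup>2 / 2\<bar>" by (rule abs_triangle_ineq4)
    also have "\<dots> = s * (1 + \<nu> / 2 * s)" using s \<nu> by (simp add: power2_eq_square algebra_simps)
    \<comment> \<open>Half of the rate \<open>\<nu>\<close> absorbs the polynomial factor; the
      remaining half is at least \<open>\<kappa>\<close>.\<close>
    also have "\<dots> \<le> s * exp (\<nu> / 2 * s)" using s by (intro mult_left_mono exp_ge_add_one_self) auto
    finally have "\<bar>s - \<nu> * s\<^sup>2 / 2\<bar> * exp (- \<nu> * s) \<le> s * exp (\<nu> / 2 * s) * exp (- \<nu> * s)"
      by (intro mult_right_mono) auto
    also have "\<dots> = s * exp (- (\<nu> / 2) * s)" by (simp add: mult.assoc flip: exp_add)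
    also have "\<dots> \<le> s * exp (- \<kappa> * s)"
      using s \<kappa> mult_right_mono[of \<kappa> "\<nu> / 2" s] by (intro mult_left_mono) auto
    finally show ?thesis by (auto simp: h_def abs_mult intro!: mult_left_mono)
  qed
  show "integral\<^sup>L (lebesgue_on {0..}) (\<lambda>s. exp (- l * s) * h s) = (l / \<nu>) / (1 + l / \<nu>) ^ 3"
    if l: "0 < l" for l
  proof -
    define p where "p = l + \<nu>"
    have p: "0 < p" "0 < \<nu>" "l = p - \<nu>" using l \<kappa> by (auto simp: p_def)
    have cont: "continuous_on {0..} h" unfolding h_def by (intro continuous_intros) auto
    \<comment> \<open>A quadratic polynomial times \<open>exp (- p * s)\<close>, found by
      undetermined coefficients: the relations \<open>AB\<close> below compare the powers of
      \<open>s\<close> and determine first \<open>A\<close>, then \<open>B\<close>, then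
      \<open>C\<close>.\<close>
    define F where "F s = \<nu>\<^sup>2 * (\<nu> / (2 * p) * s\<^sup>2 + (\<nu> / p\<^sup>2 - 1 / p) * s + (\<nu> / p ^ 3 - 1 / p\<^sup>2)) * exp (- p * s)" for s
    have "integral\<^sup>L (lebesgue_on {0..}) (\<lambda>s. exp (- l * s) * h s) = - F 0"
    proof (rule FTC_Ici)
      show "continuous_on {0..} F" unfolding F_def by (intro continuous_intros)
      show "(F \<longlongrightarrow> 0) at_top" unfolding F_def using p(1) by real_asymp
      show "integrable (lebesgue_on {0..}) (\<lambda>s. exp (- l * s) * h s)"
        using l by (intro Laplace_integrable[OF cont \<kappa>(1) bound]) auto
      show "(F has_real_derivative exp (- l * s) * h s) (at s)" for s
      proof -
        define A where "A = \<nu> / (2 * p)"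
        define B where "B = \<nu> / p\<^sup>2 - 1 / p"
        define C where "C = \<nu> / p ^ 3 - 1 / p\<^sup>2"
        have AB: "2 * A = p * B + 1" "B = p * C" "p * A = \<nu> / 2"
          using p(1) by (simp_all add: A_def B_def C_def field_simps power2_eq_square power3_eq_cube)
        have "(F has_real_derivative
            \<nu>\<^sup>2 * (2 * A * s + B - p * (A * s\<^sup>2 + B * s + C)) * exp (- p * s)) (at s)"
          unfolding F_def A_def[symmetric] B_def[symmetric] C_def[symmetric]
          by (auto intro!: derivative_eq_intros simp: algebra_simps)
        also have "2 * A * s + B - p * (A * s\<^sup>2 + B * s + C)
            = (2 * A - p * B) * s + (B - p * C) - (p * A) * s\<^sup>2"
          by (simp add: algebra_simps)
        also have "\<dots> = s - \<nu> * s\<^sup>2 / 2" using AB by simp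
        also have "\<nu>\<^sup>2 * (s - \<nu> * s\<^sup>2 / 2) * exp (- p * s) = exp (- l * s) * h s"
          by (simp add: h_def p_def algebra_simps flip: exp_add)
        finally show ?thesis .
      qed
    qed
    also have "\<dots> = \<nu>\<^sup>2 * l / p ^ 3"
      using p(1) unfolding F_def p(3) by (simp add: field_simps power2_eq_square power3_eq_cube)
    also have "\<dots> = (l / \<nu>) / (1 + l / \<nu>) ^ 3"
    proof -
      have "1 + l / \<nu> = p / \<nu>" using p(2) by (simp add: p_def field_simps)
      then show ?thesis using p by (simp add: field_simps power2_eq_square power3_eq_cube)
    qed
    finally show ?thesis .
  qed
qed

text \<open>One \<open>Blaschke_step\<close> per prescribed zero \<open>b i\<close>. Each step
  multiplies the size bound by 5 but keeps the rate, which is why \<open>\<kappa>\<close> is fixed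
  beforehand as at most half of \<open>\<nu>\<close> and of every \<open>b i\<close>.\<close>

lemma Blaschke_kernel:
  fixes \<nu> \<kappa> :: real and b :: "'i \<Rightarrow> real"
  assumes "finite W" and \<kappa>: "0 < \<kappa>" "2 * \<kappa> \<le> \<nu>" and "\<And>i. i \<in> W \<Longrightarrow> 2 * \<kappa> \<le> b i"
  shows "\<exists>h. continuous_on {0..} h \<and>
    (\<forall>s\<ge>0. \<bar>h s\<bar> \<le> 5 ^ card W * \<nu>\<^sup>2 * (s * exp (- \<kappa> * s))) \<and>
    (\<forall>l>0. integral\<^sup>L (lebesgue_on {0..}) (\<lambda>s. exp (- l * s) * h s)
      = (l / \<nu>) / (1 + l / \<nu>) ^ 3 * (\<Prod>i\<in>W. (b i - l) / (b i + l)))"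
  using assms(1,4)
proof (induction W rule: finite_induct)
  case empty
  then show ?case
    using base_kernel[OF \<kappa>] by (intro exI[of _ "\<lambda>s. \<nu>\<^sup>2 * ((s - \<nu> * s\<^sup>2 / 2) * exp (- \<nu> * s))"])
      (auto intro!: continuous_intros)
next
  case (insert i W)
  then obtain h where h: "continuous_on {0..} h"
    "\<And>s. 0 \<le> s \<Longrightarrow> \<bar>h s\<bar> \<le> 5 ^ card W * \<nu>\<^sup>2 * (s * exp (- \<kappa> * s))"
    "\<And>l. 0 < l \<Longrightarrow> integral\<^sup>L (lebesgue_on {0..}) (\<lambda>s. exp (- l * s) * h s)
      = (l / \<nu>) / (1 + l / \<nu>) ^ 3 * (\<Prod>i\<in>W. (b i - l) / (b i + l))"
    by auto
  obtain k where k: "continuous_on {0..} k"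
    "\<And>s. 0 \<le> s \<Longrightarrow> \<bar>k s\<bar> \<le> 5 * (5 ^ card W * \<nu>\<^sup>2) * (s * exp (- \<kappa> * s))"
    "\<And>l. 0 < l \<Longrightarrow> integral\<^sup>L (lebesgue_on {0..}) (\<lambda>s. exp (- l * s) * k s)
      = (b i - l) / (b i + l) * integral\<^sup>L (lebesgue_on {0..}) (\<lambda>s. exp (- l * s) * h s)"
    using Blaschke_step[OF h(1) \<kappa>(1) insert.prems[of i] h(2)] by auto
  show ?case
  proof (intro exI[of _ k] conjI allI impI k(1))
    show "\<bar>k s\<bar> \<le> 5 ^ card (insert i W) * \<nu>\<^sup>2 * (s * exp (- \<kappa> * s))" if "0 \<le> s" for s
      using k(2)[OF that] insert.hyps by (simp add: mult.assoc)
    show "integral\<^sup>L (lebesgue_on {0..}) (\<lambda>s. exp (- l * s) * k s)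
      = (l / \<nu>) / (1 + l / \<nu>) ^ 3 * (\<Prod>i\<in>insert i W. (b i - l) / (b i + l))" if "0 < l" for l
      unfolding k(3)[OF that] h(3)[OF that] using insert.hyps by (simp add: mult_ac)
  qed
qed

section \<open>Inequalities of Jensen and Schur\<close>

text \<open>The graph of \<open>x powr q\<close> lies above its tangent at \<open>B\<close>. This is
  Young's inequality with exponents \<open>q\<close> and \<open>q / (q - 1)\<close>; for
  \<open>q = 1\<close> the conjugate exponent is infinite, hence the case split.\<close>

lemma powr_tangent_le:
  fixes x B q :: real
  assumes "0 \<le> x" "0 \<le> B" "1 \<le> q"
  shows "x * B powr (q - 1) \<le> x powr q / q + (1 - 1 / q) * B powr q"
proof (cases "q = 1")
  case False
  then have q: "1 < q" using assms by simp
  have "x * B powr (q - 1) \<le> x powr q / q + (B powr (q - 1)) powr (q / (q - 1)) / (q / (q - 1))"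
    using assms q by (intro Youngs_inequality) (auto simp: field_simps)
  also have "(B powr (q - 1)) powr (q / (q - 1)) = B powr q"
    using q by (simp add: powr_powr)
  finally show ?thesis using q by (simp add: field_simps)
qed (use assms in auto)

text \<open>The tangent inequality at \<open>B = A / K\<close>, integrated against the weight
  \<open>w\<close>. Working with a bound \<open>K\<close> on the mass instead of a probability
  weight suits kernels and sums whose mass is only estimated.\<close>

lemma Jensen_powr_integral:
  fixes f w :: "'a \<Rightarrow> real"
  assumes int: "integrable M w" "integrable M (\<lambda>x. f x * w x)" "integrable M (\<lambda>x. f x powr q * w x)"
    and nonneg: "\<And>x. x \<in> space M \<Longrightarrow> 0 \<le> f x" "\<And>x. x \<in> space M \<Longrightarrow> 0 \<le> w x"
    and K: "integral\<^sup>L M w \<le> K" "0 < K" and q: "1 \<le> q"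
  shows "(\<integral>x. f x * w x \<partial>M) powr q \<le> K powr (q - 1) * (\<integral>x. f x powr q * w x \<partial>M)"
proof -
  define A where "A = (\<integral>x. f x * w x \<partial>M)"
  define B where "B = A / K"
  define I where "I = (\<integral>x. f x powr q * w x \<partial>M)"
  have A: "0 \<le> A" unfolding A_def using nonneg by (intro Bochner_Integration.integral_nonneg) auto
  then have B: "0 \<le> B" using K by (simp add: B_def)
  have AK: "A = K * B" using K by (simp add: B_def)
  have "A * B powr (q - 1) = (\<integral>x. B powr (q - 1) * (f x * w x) \<partial>M)"
    by (simp add: A_def)
  also have "\<dots> \<le> (\<integral>x. 1 / q * (f x powr q * w x) + ((1 - 1 / q) * B powr q) * w x \<partial>M)"
  proof (rule integral_mono)
    fix x assume x: "x \<in> space M"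
    have "f x * B powr (q - 1) * w x \<le> (f x powr q / q + (1 - 1 / q) * B powr q) * w x"
      using nonneg[OF x] B q by (intro mult_right_mono powr_tangent_le)
    then show "B powr (q - 1) * (f x * w x)
        \<le> 1 / q * (f x powr q * w x) + ((1 - 1 / q) * B powr q) * w x"
      by (simp add: algebra_simps)
  qed (use int in auto)
  also have "\<dots> = I / q + (1 - 1 / q) * B powr q * integral\<^sup>L M w"
    using int by (subst Bochner_Integration.integral_add) (auto simp: I_def)
  also have "\<dots> \<le> I / q + (1 - 1 / q) * B powr q * K"
    using K q by (intro add_left_mono mult_left_mono) auto
  finally have "A * B powr (q - 1) \<le> I / q + (1 - 1 / q) * B powr q * K" .
  moreover have "A * B powr (q - 1) = K * B powr q"
    unfolding AK using powr_mult_base[OF B, of "q - 1"] by simp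
  ultimately have "K * B powr q / q \<le> I / q" by (simp add: algebra_simps)
  then have "K * B powr q \<le> I" using q by (simp add: divide_le_cancel)
  then have "K powr (q - 1) * (K * B powr q) \<le> K powr (q - 1) * I"
    by (intro mult_left_mono) auto
  moreover have "A powr q = K powr (q - 1) * (K * B powr q)"
    unfolding AK using K B powr_mult_base[of K "q - 1"] by (simp add: powr_mult mult_ac)
  ultimately show ?thesis by (simp add: A_def I_def)
qed

lemma Jensen_powr_sum:
  fixes f w :: "'a \<Rightarrow> real"
  assumes "finite S" "\<And>i. i \<in> S \<Longrightarrow> 0 \<le> f i" "\<And>i. i \<in> S \<Longrightarrow> 0 \<le> w i"
    and "sum w S \<le> K" "0 < K" "1 \<le> q"
  shows "(\<Sum>i\<in>S. f i * w i) powr q \<le> K powr (q - 1) * (\<Sum>i\<in>S. f i powr q * w i)"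
  using Jensen_powr_integral[of "count_space S" w f q K] assms
  by (simp add: integrable_count_space lebesgue_integral_count_space_finite)

lemma powr_add_le:
  fixes u v q :: real
  assumes "0 \<le> u" "0 \<le> v" "0 \<le> q"
  shows "(u + v) powr q \<le> 2 powr q * (u powr q + v powr q)"
proof -
  have "(u + v) powr q \<le> (2 * max u v) powr q"
    using assms by (intro powr_mono2) auto
  also have "\<dots> = 2 powr q * max u v powr q"
    using assms by (simp add: powr_mult)
  also have "max u v powr q \<le> u powr q + v powr q"
    by (simp add: max_def)
  finally show ?thesis by simp
qed

text \<open>Jensen with the row bounds, then summation with the column bounds, shows that the
  perturbation \<open>v\<close> has at most a quarter of the \<open>q\<close>-norm of
  \<open>b\<close>. After \<open>powr_add_le\<close> the sum for \<open>b\<close> returns with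
  factor \<open>(2 / 4) powr q \<le> 1 / 2\<close> and is absorbed on the left.\<close>

lemma Schur_absorb:
  fixes b u :: "'a \<Rightarrow> real" and k :: "'a \<Rightarrow> 'a \<Rightarrow> real"
  assumes S: "finite S" and q: "1 \<le> q"
    and b: "\<And>n. n \<in> S \<Longrightarrow> 0 \<le> b n" and u: "\<And>n. n \<in> S \<Longrightarrow> 0 \<le> u n"
    and k: "\<And>n m. 0 \<le> k n m"
    and rows: "\<And>n. n \<in> S \<Longrightarrow> (\<Sum>m\<in>S. k n m) \<le> 1 / 4"
    and cols: "\<And>m. m \<in> S \<Longrightarrow> (\<Sum>n\<in>S. k n m) \<le> 1 / 4"
    and le: "\<And>n. n \<in> S \<Longrightarrow> b n \<le> u n + (\<Sum>m\<in>S. b m * k n m)"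
  shows "(\<Sum>n\<in>S. b n powr q) \<le> 2 * 2 powr q * (\<Sum>n\<in>S. u n powr q)"
proof -
  define v where "v n = (\<Sum>m\<in>S. b m * k n m)" for n
  have v: "0 \<le> v n" for n unfolding v_def using b k by (intro sum_nonneg) auto
  have "(\<Sum>n\<in>S. v n powr q) \<le> (\<Sum>n\<in>S. (1 / 4) powr (q - 1) * (\<Sum>m\<in>S. b m powr q * k n m))"
    unfolding v_def using S q b k rows by (intro sum_mono Jensen_powr_sum) auto
  also have "\<dots> = (1 / 4) powr (q - 1) * (\<Sum>m\<in>S. b m powr q * (\<Sum>n\<in>S. k n m))"
    using sum.swap[of "\<lambda>n m. b m powr q * k n m" S S] by (simp flip: sum_distrib_left)
  also have "\<dots> \<le> (1 / 4) powr (q - 1) * (\<Sum>m\<in>S. b m powr q * (1 / 4))"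
    using cols by (intro mult_left_mono sum_mono) auto
  also have "\<dots> = (1 / 4) powr q * (\<Sum>m\<in>S. b m powr q)"
    using powr_mult_base[of "1 / 4" "q - 1"] by (simp add: sum_distrib_right[symmetric] mult_ac flip: sum_divide_distrib)
  finally have v_sum: "(\<Sum>n\<in>S. v n powr q) \<le> (1 / 4) powr q * (\<Sum>m\<in>S. b m powr q)" .
  have "(\<Sum>n\<in>S. b n powr q) \<le> (\<Sum>n\<in>S. 2 powr q * (u n powr q + v n powr q))"
  proof (rule sum_mono)
    fix n assume n: "n \<in> S"
    have "b n powr q \<le> (u n + v n) powr q"
      using le[OF n] b[OF n] q by (intro powr_mono2) (auto simp: v_def)
    also have "\<dots> \<le> 2 powr q * (u n powr q + v n powr q)"
      using u[OF n] v q by (intro powr_add_le) auto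
    finally show "b n powr q \<le> 2 powr q * (u n powr q + v n powr q)" .
  qed
  also have "\<dots> = 2 powr q * (\<Sum>n\<in>S. u n powr q) + 2 powr q * (\<Sum>n\<in>S. v n powr q)"
    by (simp add: sum.distrib sum_distrib_left distrib_left)
  also have "2 powr q * (\<Sum>n\<in>S. v n powr q) \<le> 2 powr q * ((1 / 4) powr q * (\<Sum>m\<in>S. b m powr q))"
    by (intro mult_left_mono v_sum) auto
  also have "2 powr q * ((1 / 4) powr q * (\<Sum>m\<in>S. b m powr q)) = (1 / 2) powr q * (\<Sum>m\<in>S. b m powr q)"
    by (simp flip: powr_mult mult.assoc)
  also have "(1 / 2) powr q * (\<Sum>m\<in>S. b m powr q) \<le> 1 / 2 * (\<Sum>m\<in>S. b m powr q)"
    using powr_mono'[of 1 q "1 / 2"] q by (intro mult_right_mono sum_nonneg) auto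
  finally show ?thesis by simp
qed

section \<open>Lacunary exponential sums\<close>

definition exp_sum :: "(nat \<Rightarrow> real) \<Rightarrow> nat set \<Rightarrow> (nat \<Rightarrow> complex) \<Rightarrow> real \<Rightarrow> complex" where
  "exp_sum \<nu> S a s = (\<Sum>n\<in>S. a n * complex_of_real (exp (- \<nu> n * s)))"

lemma continuous_on_exp_sum: "continuous_on A (exp_sum \<nu> S a)"
  unfolding exp_sum_def by (intro continuous_intros)

lemma lacunary_ratio_ge_first:
  assumes "lacunary_ratio r \<nu>"
  shows "\<nu> 0 \<le> \<nu> n"
proof -
  have "1 * \<nu> 0 \<le> r ^ n * \<nu> 0"
    using lacunary_ratioD[OF assms] by (intro mult_right_mono one_le_power) (auto simp: less_imp_le)
  also have "\<dots> \<le> \<nu> n" using lacunary_ratio_power[OF assms, of 0 n] by simp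
  finally show ?thesis by simp
qed

lemma norm_exp_sum_le:
  assumes "lacunary_ratio r \<nu>" "0 \<le> s"
  shows "norm (exp_sum \<nu> S a s) \<le> (\<Sum>n\<in>S. norm (a n)) * exp (- \<nu> 0 * s)"
proof -
  have "norm (exp_sum \<nu> S a s) \<le> (\<Sum>n\<in>S. norm (a n) * exp (- \<nu> n * s))"
    unfolding exp_sum_def by (rule order_trans[OF norm_sum]) (simp add: norm_mult)
  also have "\<dots> \<le> (\<Sum>n\<in>S. norm (a n) * exp (- \<nu> 0 * s))"
    using assms lacunary_ratio_ge_first[OF assms(1)]
    by (intro sum_mono mult_left_mono) (auto intro!: mult_right_mono)
  finally show ?thesis by (simp add: sum_distrib_right)
qed

lemma norm_exp_sum_le':
  assumes "lacunary_ratio r \<nu>" "0 \<le> s"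
  shows "norm (exp_sum \<nu> S a s) \<le> (\<Sum>n\<in>S. norm (a n))"
proof -
  have "(\<Sum>n\<in>S. norm (a n)) * exp (- \<nu> 0 * s) \<le> (\<Sum>n\<in>S. norm (a n)) * 1"
    using assms lacunary_ratioD(2)[OF assms(1), of 0] by (intro mult_left_mono sum_nonneg) auto
  then show ?thesis using norm_exp_sum_le[OF assms, of S a] by simp
qed

lemma continuous_on_norm_powr:
  fixes f :: "'a::topological_space \<Rightarrow> 'b::real_normed_vector"
  assumes "continuous_on A f" "0 < q"
  shows "continuous_on A (\<lambda>x. norm (f x) powr q)"
  using assms by (intro continuous_on_powr' continuous_intros) auto

lemma integrable_exp_sum_powr:
  assumes \<nu>: "lacunary_ratio r \<nu>" and q: "0 < q"
  shows "integrable (lebesgue_on {0..}) (\<lambda>s. norm (exp_sum \<nu> S a s) powr q)"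
proof (rule integrable_Ici_exp_bound)
  show "continuous_on {0..} (\<lambda>s. norm (exp_sum \<nu> S a s) powr q)"
    by (intro continuous_on_norm_powr continuous_on_exp_sum q)
  show "0 < q * \<nu> 0" using q lacunary_ratioD(2)[OF \<nu>] by simp
  show "norm (norm (exp_sum \<nu> S a s) powr q) \<le> (\<Sum>n\<in>S. norm (a n)) powr q * exp (- (q * \<nu> 0) * s)"
    if "0 \<le> s" for s
  proof -
    have "norm (exp_sum \<nu> S a s) powr q \<le> ((\<Sum>n\<in>S. norm (a n)) * exp (- \<nu> 0 * s)) powr q"
      using q by (intro powr_mono2 norm_exp_sum_le[OF \<nu> that]) auto
    also have "\<dots> = (\<Sum>n\<in>S. norm (a n)) powr q * exp (- (q * \<nu> 0) * s)"
      by (simp add: powr_mult sum_nonneg exp_powr_real mult_ac)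
    finally show ?thesis by simp
  qed
qed

section \<open>Coefficients controlled by the norm, by duality with the kernels\<close>

lemma exp_sum_pairing:
  fixes h :: "real \<Rightarrow> real"
  assumes \<nu>: "lacunary_ratio r \<nu>"
    and h: "continuous_on {0..} h" "0 < \<kappa>" "\<And>s. 0 \<le> s \<Longrightarrow> \<bar>h s\<bar> \<le> D * (s * exp (- \<kappa> * s))"
  shows "(\<integral>s. exp_sum \<nu> S a s * complex_of_real (h s) \<partial>lebesgue_on {0..})
    = (\<Sum>n\<in>S. a n * complex_of_real (\<integral>s. exp (- \<nu> n * s) * h s \<partial>lebesgue_on {0..}))"
proof -
  have int: "integrable (lebesgue_on {0..}) (\<lambda>s. exp (- \<nu> n * s) * h s)" for n
    using lacunary_ratioD(2)[OF \<nu>, of n] by (intro Laplace_integrable[OF h]) auto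
  have "(\<integral>s. exp_sum \<nu> S a s * complex_of_real (h s) \<partial>lebesgue_on {0..})
    = (\<integral>s. (\<Sum>n\<in>S. a n * complex_of_real (exp (- \<nu> n * s) * h s)) \<partial>lebesgue_on {0..})"
    by (simp add: exp_sum_def sum_distrib_right mult.assoc)
  also have "\<dots> = (\<Sum>n\<in>S. a n * (\<integral>s. complex_of_real (exp (- \<nu> n * s) * h s) \<partial>lebesgue_on {0..}))"
    using int by (subst Bochner_Integration.integral_sum)
      (auto intro!: integrable_mult_right integrable_of_real simp del: of_real_mult)
  also have "\<dots> = (\<Sum>n\<in>S. a n * complex_of_real (\<integral>s. exp (- \<nu> n * s) * h s \<partial>lebesgue_on {0..}))"
    by (simp only: integral_complex_of_real)
  finally show ?thesis .
qed

text \<open>Jensen with weight \<open>\<bar>h s\<bar>\<close>, whose mass is at most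
  \<open>D * (4 / \<kappa>\<^sup>2)\<close>. The weight stays inside the integral so that the
  weights of all kernels can later be summed pointwise.\<close>

lemma powr_Jensen_pairing:
  fixes h :: "real \<Rightarrow> real" and F :: "real \<Rightarrow> complex"
  assumes F: "continuous_on {0..} F" "\<And>s. 0 \<le> s \<Longrightarrow> norm (F s) \<le> A"
    and h: "continuous_on {0..} h" "0 < \<kappa>" "\<And>s. 0 \<le> s \<Longrightarrow> \<bar>h s\<bar> \<le> D * (s * exp (- \<kappa> * s))"
    and q: "1 \<le> q" and K: "D * (4 / \<kappa>\<^sup>2) \<le> K" "0 < K"
  shows "norm (\<integral>s. F s * complex_of_real (h s) \<partial>lebesgue_on {0..}) powr q
    \<le> K powr (q - 1) * (\<integral>s. norm (F s) powr q * \<bar>h s\<bar> \<partial>lebesgue_on {0..})"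
    and "integrable (lebesgue_on {0..}) (\<lambda>s. norm (F s) powr q * \<bar>h s\<bar>)"
proof -
  have D: "0 \<le> D"
    using order_trans[OF abs_ge_zero h(3)[of 1]] by (simp add: zero_le_mult_iff)
  have int_h: "integrable (lebesgue_on {0..}) (\<lambda>s. \<bar>h s\<bar>)"
    using h(3) by (intro integrable_Ici_mult_exp_bound[OF _ h(2), where D = D])
      (auto intro!: continuous_intros h(1))
  have bound: "\<bar>g s\<bar> * \<bar>h s\<bar> \<le> B * D * (s * exp (- \<kappa> * s))"
    if "0 \<le> s" "\<bar>g s\<bar> \<le> B" for s B and g :: "real \<Rightarrow> real"
  proof -
    have "\<bar>g s\<bar> * \<bar>h s\<bar> \<le> B * (D * (s * exp (- \<kappa> * s)))"
      using that h(3)[of s] by (intro mult_mono) auto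
    then show ?thesis by (simp add: mult.assoc)
  qed
  have int_Fh: "integrable (lebesgue_on {0..}) (\<lambda>s. norm (F s) * \<bar>h s\<bar>)"
    using bound[of _ "\<lambda>s. norm (F s)" A] F(2)
    by (intro integrable_Ici_mult_exp_bound[OF _ h(2), where D = "A * D"])
      (auto intro!: continuous_intros h F)
  show int_Fqh: "integrable (lebesgue_on {0..}) (\<lambda>s. norm (F s) powr q * \<bar>h s\<bar>)"
    using bound[of _ "\<lambda>s. norm (F s) powr q" "A powr q"] powr_mono2[OF _ norm_ge_zero F(2), of q] q
    by (intro integrable_Ici_mult_exp_bound[OF _ h(2), where D = "A powr q * D"])
      (auto intro!: continuous_intros continuous_on_norm_powr h F)
  have "(\<integral>s. \<bar>h s\<bar> \<partial>lebesgue_on {0..}) \<le> (\<integral>s. D * (s * exp (- \<kappa> * s)) \<partial>lebesgue_on {0..})"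
    using h(3) mult_exp_integral_Ici(1)[OF h(2)] by (intro integral_mono int_h) auto
  also have "\<dots> \<le> D * (4 / \<kappa>\<^sup>2)"
    using mult_exp_integral_Ici[OF h(2)] D by (simp only: integral_mult_right_zero mult_left_mono)
  finally have le_K: "(\<integral>s. \<bar>h s\<bar> \<partial>lebesgue_on {0..}) \<le> K" using K by simp
  have "norm (\<integral>s. F s * complex_of_real (h s) \<partial>lebesgue_on {0..})
      \<le> (\<integral>s. norm (F s) * \<bar>h s\<bar> \<partial>lebesgue_on {0..})"
    using integral_norm_bound[of "lebesgue_on {0..}" "\<lambda>s. F s * complex_of_real (h s)"]
    by (simp add: norm_mult)
  then have "norm (\<integral>s. F s * complex_of_real (h s) \<partial>lebesgue_on {0..}) powr q
      \<le> (\<integral>s. norm (F s) * \<bar>h s\<bar> \<partial>lebesgue_on {0..}) powr q"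
    using q by (intro powr_mono2) auto
  also have "\<dots> \<le> K powr (q - 1) * (\<integral>s. norm (F s) powr q * \<bar>h s\<bar> \<partial>lebesgue_on {0..})"
    using q K(2) le_K by (intro Jensen_powr_integral int_h int_Fh int_Fqh) auto
  finally show "norm (\<integral>s. F s * complex_of_real (h s) \<partial>lebesgue_on {0..}) powr q
    \<le> K powr (q - 1) * (\<integral>s. norm (F s) powr q * \<bar>h s\<bar> \<partial>lebesgue_on {0..})" .
qed

text \<open>For large \<open>x\<close> the worst case is \<open>q = 1\<close>, where
  \<open>x\<^sup>2 / (1 + x) ^ 3 \<le> 1 / x\<close>; a square in the denominator would leave no
  decay. For \<open>x \<le> 1\<close> the factors \<open>x powr (1 / q)\<close> and
  \<open>1 / (1 + x) ^ 3\<close> are at most 1.\<close>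

lemma Laplace_symbol_le:
  fixes x q :: real
  assumes "0 < x" "1 \<le> q"
  shows "x powr (1 / q) * (x / (1 + x) ^ 3) \<le> min x (1 / x)"
proof (cases "x \<le> 1")
  case True
  then have "min x (1 / x) = x" using assms by (auto simp: min_def field_simps intro: mult_le_one)
  moreover have "x powr (1 / q) \<le> 1" using True assms by (intro powr_le1) auto
  moreover have "x / (1 + x) ^ 3 \<le> x"
    using assms one_le_power[of "1 + x" 3] by (simp add: divide_le_eq mult_le_cancel_left1)
  ultimately show ?thesis
    using assms mult_mono[of "x powr (1 / q)" 1 "x / (1 + x) ^ 3" x] by simp
next
  case False
  then have 1: "1 < x" by simp
  then have "min x (1 / x) = 1 / x"
    using less_1_mult[OF 1 1] by (auto simp: min_def field_simps)
  moreover have "x powr (1 / q) \<le> x powr 1" using 1 assms by (intro powr_mono) auto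
  then have "x powr (1 / q) * (x / (1 + x) ^ 3) \<le> x * (x / (1 + x) ^ 3)"
    using 1 by (intro mult_right_mono) auto
  moreover have "x ^ 3 \<le> (1 + x) ^ 3" using 1 by (intro power_mono) auto
  then have "x * (x / (1 + x) ^ 3) \<le> 1 / x"
  proof -
    have "x * (x / (1 + x) ^ 3) \<le> x * (x / x ^ 3)"
      using 1 \<open>x ^ 3 \<le> (1 + x) ^ 3\<close> by (intro mult_left_mono divide_left_mono mult_pos_pos) auto
    also have "\<dots> = 1 / x" using 1 by (simp add: field_simps power3_eq_cube)
    finally show ?thesis .
  qed
  ultimately show ?thesis by simp
qed

lemma norm_Blaschke_prod_le_1:
  fixes \<nu> :: "'i \<Rightarrow> real"
  assumes "\<And>i. i \<in> W \<Longrightarrow> 0 < \<nu> i" "0 < l"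
  shows "\<bar>\<Prod>i\<in>W. (\<nu> i - l) / (\<nu> i + l)\<bar> \<le> 1"
  unfolding abs_prod
proof (rule prod_le_1)
  fix i assume "i \<in> W"
  then show "0 \<le> \<bar>(\<nu> i - l) / (\<nu> i + l)\<bar> \<and> \<bar>(\<nu> i - l) / (\<nu> i + l)\<bar> \<le> 1"
    using assms(1)[of i] assms(2) by (auto simp: abs_divide divide_le_eq)
qed

lemma lacunary_ratio_quotient_sum:
  assumes \<nu>: "lacunary_ratio r \<nu>" and \<gamma>: "0 < \<gamma>" and S: "finite S"
  shows "(\<Sum>m\<in>S. min (\<nu> m / \<nu> n) (\<nu> n / \<nu> m) powr \<gamma>) \<le> 2 / (1 - r powr (-\<gamma>))"
proof -
  have "lacunary_ratio r (\<lambda>m. (1 / \<nu> n) * \<nu> m)"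
    using lacunary_ratioD(2)[OF \<nu>] by (intro lacunary_ratio_scale[OF \<nu>]) auto
  from lacunary_ratio_min_sum[OF this \<gamma> S] show ?thesis by simp
qed

text \<open>The functional built from the Blaschke kernel annihilates the exponents \<open>\<nu> m\<close> comparable
  to \<open>\<nu> n\<close>; the others contribute little since the Laplace transform of the kernel decays
  at \<open>0\<close> and at infinity. Absorbing the latter by Schur's test gives the bound.\<close>

lemma exp_sum_coefficient_functional:
  fixes \<nu> :: "nat \<Rightarrow> real" and a :: "nat \<Rightarrow> complex"
  assumes \<nu>: "lacunary_ratio r \<nu>" and S: "finite S" "n \<in> S" and R: "1 \<le> R" and q: "1 \<le> q"
    and c: "c = exp (- (2 * r / (r - 1)) * (2 / (1 - 1 / r))) / 8"
    and N: "2 * R / (1 - 1 / r) \<le> real N"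
  shows "\<exists>h. continuous_on {0..} h \<and>
    (\<forall>s\<ge>0. \<bar>h s\<bar> \<le> 5 ^ N * (\<nu> n)\<^sup>2 * (s * exp (- (\<nu> n / (2 * R)) * s))) \<and>
    c * (norm (a n) * \<nu> n powr (- 1 / q))
      \<le> norm (\<integral>s. exp_sum \<nu> S a s * complex_of_real (h s) \<partial>lebesgue_on {0..}) * \<nu> n powr (- 1 / q)
        + (\<Sum>m\<in>S. norm (a m) * \<nu> m powr (- 1 / q)
            * (R powr (- 1 / 2) * min (\<nu> m / \<nu> n) (\<nu> n / \<nu> m) powr (1 / 2)))"
proof -
  note \<nu>D = lacunary_ratioD[OF \<nu>]
  define y where "y m = min (\<nu> m / \<nu> n) (\<nu> n / \<nu> m)" for m
  have y: "0 < y m" for m using \<nu>D(2) by (simp add: y_def)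
  \<comment> \<open>The exponents within a factor \<open>R\<close> of \<open>\<nu> n\<close>, other
    than \<open>\<nu> n\<close> itself: the zeros to be imposed.\<close>
  define W where "W = {m\<in>S. m \<noteq> n \<and> 1 / R \<le> y m}"
  \<comment> \<open>Every exponent in \<open>W\<close>, and \<open>\<nu> n\<close> too, is at least
    \<open>\<nu> n / R = 2 * \<kappa>\<close>, as \<open>Blaschke_kernel\<close> requires.\<close>
  define \<kappa> where "\<kappa> = \<nu> n / (2 * R)"
  have W: "finite W" "W \<subseteq> S" "n \<notin> W" using S by (auto simp: W_def)
  have \<kappa>: "0 < \<kappa>" "2 * \<kappa> \<le> \<nu> n"
    using R \<nu>D(2)[of n] by (auto simp: \<kappa>_def divide_le_eq mult_le_cancel_left1)
  have \<kappa>W: "2 * \<kappa> \<le> \<nu> m" if "m \<in> W" for m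
  proof -
    have "1 / R \<le> \<nu> m / \<nu> n" using that by (auto simp: W_def y_def)
    then have "1 / R * \<nu> n \<le> \<nu> m" using \<nu>D(2)[of n] by (simp add: pos_le_divide_eq)
    then show ?thesis by (simp add: \<kappa>_def)
  qed
  \<comment> \<open>Each element of \<open>W\<close> contributes at least \<open>1 / R\<close> to a
    sum bounded in terms of \<open>r\<close>, so the number of zeros is bounded independently of
    \<open>n\<close> and \<open>S\<close>.\<close>
  have "real (card W) * (1 / R) \<le> (\<Sum>m\<in>W. y m powr 1)"
    using y by (intro sum_bounded_below) (auto simp: W_def less_imp_le)
  also have "\<dots> \<le> 2 / (1 - r powr (- 1))"
    unfolding y_def by (rule lacunary_ratio_quotient_sum[OF \<nu> _ W(1)]) simp
  finally have "real (card W) \<le> 2 / (1 - 1 / r) * R"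
    using R \<nu>D(1) by (simp add: powr_minus_divide pos_divide_le_eq)
  then have card: "card W \<le> N" using N by simp
  obtain h where h: "continuous_on {0..} h"
    "\<And>s. 0 \<le> s \<Longrightarrow> \<bar>h s\<bar> \<le> 5 ^ card W * (\<nu> n)\<^sup>2 * (s * exp (- \<kappa> * s))"
    "\<And>l. 0 < l \<Longrightarrow> (\<integral>s. exp (- l * s) * h s \<partial>lebesgue_on {0..})
      = (l / \<nu> n) / (1 + l / \<nu> n) ^ 3 * (\<Prod>m\<in>W. (\<nu> m - l) / (\<nu> m + l))"
    using Blaschke_kernel[where b = \<nu>, OF W(1) \<kappa> \<kappa>W] by blast
  define L where "L m = (\<integral>s. exp (- \<nu> m * s) * h s \<partial>lebesgue_on {0..})" for m
  define \<phi> where "\<phi> = (\<integral>s. exp_sum \<nu> S a s * complex_of_real (h s) \<partial>lebesgue_on {0..})"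
  have \<phi>: "\<phi> = (\<Sum>m\<in>S. a m * complex_of_real (L m))"
    unfolding \<phi>_def L_def by (rule exp_sum_pairing[OF \<nu> h(1) \<kappa>(1) h(2)])
  have L_eq: "L m = (\<nu> m / \<nu> n) / (1 + \<nu> m / \<nu> n) ^ 3 * (\<Prod>i\<in>W. (\<nu> i - \<nu> m) / (\<nu> i + \<nu> m))" for m
    unfolding L_def by (rule h(3)) (rule \<nu>D(2))
  have L_W: "L m = 0" if "m \<in> W" for m
    using that W(1) by (auto simp: L_eq)
  \<comment> \<open>At \<open>l = \<nu> n\<close> the base transform is
    \<open>1 / (1 + 1) ^ 3\<close>, the origin of the 8 in \<open>c\<close>; the rest is the
    Blaschke product.\<close>
  have L_n: "c \<le> \<bar>L n\<bar>"
  proof -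
    have "L n = (\<Prod>i\<in>W. (\<nu> i - \<nu> n) / (\<nu> i + \<nu> n)) / 8"
      using \<nu>D(2)[of n] by (simp add: L_eq)
    then have "\<bar>L n\<bar> = \<bar>\<Prod>i\<in>W. (\<nu> i - \<nu> n) / (\<nu> i + \<nu> n)\<bar> / 8" by simp
    then show ?thesis
      using Blaschke_product_ge[OF \<nu> W(1,3)] unfolding abs_prod c by simp
  qed
  have L_far: "\<nu> n powr (- 1 / q) * \<bar>L m\<bar>
      \<le> \<nu> m powr (- 1 / q) * (R powr (- 1 / 2) * y m powr (1 / 2))" if m: "m \<in> S" "m \<noteq> n" for m
  proof (cases "m \<in> W")
    case False
    then have "y m \<le> 1 / R" using m by (auto simp: W_def)
    define x where "x = \<nu> m / \<nu> n"
    have x: "0 < x" "\<nu> n = \<nu> m / x" using \<nu>D(2)[of m] \<nu>D(2)[of n] by (auto simp: x_def)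
    have "\<bar>L m\<bar> = x / (1 + x) ^ 3 * \<bar>\<Prod>i\<in>W. (\<nu> i - \<nu> m) / (\<nu> i + \<nu> m)\<bar>"
      using x(1) by (simp add: L_eq abs_mult flip: x_def)
    also have "\<dots> \<le> x / (1 + x) ^ 3 * 1"
      using x(1) \<nu>D(2) by (intro mult_left_mono norm_Blaschke_prod_le_1) auto
    finally have "x powr (1 / q) * \<bar>L m\<bar> \<le> x powr (1 / q) * (x / (1 + x) ^ 3)"
      by (intro mult_left_mono) auto
    also have "\<dots> \<le> y m"
      using Laplace_symbol_le[OF x(1) q] by (simp add: y_def x_def)
    \<comment> \<open>One half power yields the small factor \<open>R powr (- 1 / 2)\<close> since
      \<open>m\<close> is far from \<open>n\<close>; the other half remains summable over
      \<open>m\<close>.\<close>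
    also have "y m = y m powr (1 / 2) * y m powr (1 / 2)"
      using y[of m] by (simp flip: powr_add)
    also have "\<dots> \<le> (1 / R) powr (1 / 2) * y m powr (1 / 2)"
      using y[of m] \<open>y m \<le> 1 / R\<close> by (intro mult_right_mono powr_mono2) auto
    also have "(1 / R) powr (1 / 2) = R powr (- 1 / 2)"
      using R by (simp add: powr_divide powr_minus_divide)
    finally have "\<nu> m powr (- 1 / q) * (x powr (1 / q) * \<bar>L m\<bar>)
        \<le> \<nu> m powr (- 1 / q) * (R powr (- 1 / 2) * y m powr (1 / 2))"
      by (intro mult_left_mono) auto
    moreover have "\<nu> n powr (- 1 / q) = \<nu> m powr (- 1 / q) * x powr (1 / q)"
      unfolding x(2) using x(1) \<nu>D(2)[of m] by (simp add: powr_divide powr_minus_divide)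
    ultimately show ?thesis by (simp add: mult.assoc)
  qed (simp add: L_W)
  have "c * norm (a n) \<le> norm (a n * complex_of_real (L n))"
    using L_n mult_right_mono[OF L_n, of "norm (a n)"] by (simp add: norm_mult mult.commute)
  also have "a n * complex_of_real (L n) = \<phi> - (\<Sum>m\<in>S - {n}. a m * complex_of_real (L m))"
    unfolding \<phi> using S by (simp add: sum.remove)
  also have "norm \<dots> \<le> norm \<phi> + (\<Sum>m\<in>S - {n}. norm (a m) * \<bar>L m\<bar>)"
    by (rule order_trans[OF norm_triangle_ineq4])
      (auto intro!: add_left_mono sum_norm_le simp: norm_mult)
  finally have "c * norm (a n) * \<nu> n powr (- 1 / q)
      \<le> (norm \<phi> + (\<Sum>m\<in>S - {n}. norm (a m) * \<bar>L m\<bar>)) * \<nu> n powr (- 1 / q)"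
    by (intro mult_right_mono) auto
  also have "\<dots> = norm \<phi> * \<nu> n powr (- 1 / q)
      + (\<Sum>m\<in>S - {n}. norm (a m) * (\<nu> n powr (- 1 / q) * \<bar>L m\<bar>))"
    by (simp only: distrib_right distrib_left sum_distrib_right sum_distrib_left mult_ac)
  also have "(\<Sum>m\<in>S - {n}. norm (a m) * (\<nu> n powr (- 1 / q) * \<bar>L m\<bar>))
      \<le> (\<Sum>m\<in>S - {n}. norm (a m) * (\<nu> m powr (- 1 / q) * (R powr (- 1 / 2) * y m powr (1 / 2))))"
    using L_far by (intro sum_mono mult_left_mono) auto
  also have "\<dots> \<le> (\<Sum>m\<in>S. norm (a m) * (\<nu> m powr (- 1 / q) * (R powr (- 1 / 2) * y m powr (1 / 2))))"
    using S by (intro sum_mono2) auto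
  finally have main: "c * (norm (a n) * \<nu> n powr (- 1 / q)) \<le> norm \<phi> * \<nu> n powr (- 1 / q)
      + (\<Sum>m\<in>S. norm (a m) * \<nu> m powr (- 1 / q) * (R powr (- 1 / 2) * y m powr (1 / 2)))"
    by (simp add: mult.assoc)
  show ?thesis
  proof (intro exI[of _ h] conjI allI impI h(1))
    show "\<bar>h s\<bar> \<le> 5 ^ N * (\<nu> n)\<^sup>2 * (s * exp (- (\<nu> n / (2 * R)) * s))" if "0 \<le> s" for s
    proof -
      have "(5::real) ^ card W \<le> 5 ^ N" using card by (intro power_increasing) auto
      then have "5 ^ card W * (\<nu> n)\<^sup>2 * (s * exp (- \<kappa> * s)) \<le> 5 ^ N * (\<nu> n)\<^sup>2 * (s * exp (- \<kappa> * s))"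
        using that by (intro mult_right_mono) auto
      then show ?thesis using h(2)[OF that] by (simp add: \<kappa>_def)
    qed
  qed (use main in \<open>unfold \<phi>_def y_def\<close>)
qed

lemma powr_mult_powr_inverse:
  fixes \<nu> x q :: real
  assumes "0 < \<nu>" "0 \<le> x" "1 \<le> q"
  shows "(x * \<nu> powr (- 1 / q)) powr q = x powr q / \<nu>"
proof -
  have "(\<nu> powr (- 1 / q)) powr q = \<nu> powr (- 1)"
    using assms by (simp add: powr_powr)
  also have "\<dots> = 1 / \<nu>" using assms by (simp add: powr_minus_divide)
  finally show ?thesis using assms by (simp add: powr_mult)
qed

text \<open>Each normalised coefficient \<open>b n\<close> is at most the pairing of
  \<open>F\<close> with its own kernel plus a small multiple of the others, which
  \<open>Schur_absorb\<close> removes. Jensen and summation over \<open>n\<close> under the integral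
  turn the pairings back into the norm. The constants are chosen in the order \<open>c\<close>,
  \<open>R\<close>, \<open>N\<close> and never involve \<open>\<nu>\<close>, \<open>S\<close> or
  \<open>a\<close>.\<close>

lemma exp_sum_coefficients_le:
  fixes r q :: real
  assumes r: "1 < r" and q: "1 \<le> q"
  obtains C where "0 < C"
    "\<And>\<nu> S a. lacunary_ratio r \<nu> \<Longrightarrow> finite S \<Longrightarrow>
      (\<Sum>n\<in>S. norm (a n) powr q / \<nu> n)
        \<le> C * (\<integral>s. norm (exp_sum \<nu> S a s) powr q \<partial>lebesgue_on {0..})"
proof -
  define c where "c = exp (- (2 * r / (r - 1)) * (2 / (1 - 1 / r))) / 8"
  define T where "T = 2 / (1 - r powr (- 1 / 2))"
  have c: "0 < c" by (simp add: c_def)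
  have "r powr (- 1 / 2) < r powr 0" using r by (intro powr_less_mono) auto
  then have T: "0 < T" using r by (simp add: T_def)
  \<comment> \<open>Large enough that the row sums, at most \<open>R powr (- 1 / 2) * T / c\<close>,
    meet the threshold \<open>1 / 4\<close> of \<open>Schur_absorb\<close>. There is no circularity,
    as \<open>c\<close> and \<open>T\<close> depend on \<open>r\<close> only.\<close>
  define R where "R = max 1 ((4 * T / c)\<^sup>2)"
  have R: "1 \<le> R" by (simp add: R_def)
  have "4 * T / c = ((4 * T / c)\<^sup>2) powr (1 / 2)"
    using T c by (simp add: powr_half_sqrt)
  also have "\<dots> \<le> R powr (1 / 2)" by (intro powr_mono2) (auto simp: R_def)
  finally have RT: "R powr (- 1 / 2) * T / c \<le> 1 / 4"
    using R T c by (simp add: powr_minus_divide field_simps)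
  obtain N :: nat where N: "2 * R / (1 - 1 / r) \<le> real N" using real_arch_simple by blast
  have cR: "0 < 1 / (2 * R)" using R by simp
  obtain C1 where C1: "0 < C1" "\<And>y S. lacunary_ratio r y \<Longrightarrow> finite S \<Longrightarrow>
      (\<Sum>n\<in>S. y n powr 1 * exp (- (1 / (2 * R)) * y n)) \<le> C1"
    using lacunary_ratio_exp_sum[OF zero_less_one cR r] by blast
  define D :: real where "D = 5 ^ N"
  \<comment> \<open>The mass bound \<open>D * (\<nu> n)\<^sup>2 * (4 / \<kappa>\<^sup>2)\<close> of
    the \<open>n\<close>-th kernel with \<open>\<kappa> = \<nu> n / (2 * R)\<close>; the exponent
    cancels.\<close>
  define K where "K = 16 * R\<^sup>2 * D"
  have D: "0 < D" by (simp add: D_def)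
  have K: "0 < K" using D R by (simp add: K_def)
  define C where "C = 2 * 2 powr q * (c powr (- q) * K powr (q - 1) * D * C1)"
  show ?thesis
  proof (rule that[of C])
    show "0 < C" using c K D C1 by (simp add: C_def)
    fix \<nu> :: "nat \<Rightarrow> real" and S :: "nat set" and a :: "nat \<Rightarrow> complex"
    assume \<nu>: "lacunary_ratio r \<nu>" and S: "finite S"
    note \<nu>D = lacunary_ratioD[OF \<nu>]
    define F where "F = exp_sum \<nu> S a"
    define b where "b n = norm (a n) * \<nu> n powr (- 1 / q)" for n
    define k where "k n m = R powr (- 1 / 2) * min (\<nu> m / \<nu> n) (\<nu> n / \<nu> m) powr (1 / 2) / c" for n m
    have F_cont: "continuous_on {0..} F" unfolding F_def by (rule continuous_on_exp_sum)
    have F_bound: "norm (F s) \<le> (\<Sum>n\<in>S. norm (a n))" if "0 \<le> s" for s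
      unfolding F_def by (rule norm_exp_sum_le'[OF \<nu> that])
    define P where "P n h \<longleftrightarrow> continuous_on {0..} h
        \<and> (\<forall>s\<ge>0. \<bar>h s\<bar> \<le> D * (\<nu> n)\<^sup>2 * (s * exp (- (\<nu> n / (2 * R)) * s)))
        \<and> b n \<le> norm (\<integral>s. F s * complex_of_real (h s) \<partial>lebesgue_on {0..}) * \<nu> n powr (- 1 / q) / c
            + (\<Sum>m\<in>S. b m * k n m)" for n and h :: "real \<Rightarrow> real"
    have "\<exists>h. P n h" if n: "n \<in> S" for n
    proof -
      obtain h where h: "continuous_on {0..} h"
        "\<forall>s\<ge>0. \<bar>h s\<bar> \<le> 5 ^ N * (\<nu> n)\<^sup>2 * (s * exp (- (\<nu> n / (2 * R)) * s))"
        "c * (norm (a n) * \<nu> n powr (- 1 / q))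
          \<le> norm (\<integral>s. exp_sum \<nu> S a s * complex_of_real (h s) \<partial>lebesgue_on {0..}) * \<nu> n powr (- 1 / q)
            + (\<Sum>m\<in>S. norm (a m) * \<nu> m powr (- 1 / q)
                * (R powr (- 1 / 2) * min (\<nu> m / \<nu> n) (\<nu> n / \<nu> m) powr (1 / 2)))"
        using exp_sum_coefficient_functional[OF \<nu> S n R q c_def N, of a] by blast
      have "c * b n \<le> norm (\<integral>s. F s * complex_of_real (h s) \<partial>lebesgue_on {0..}) * \<nu> n powr (- 1 / q)
            + (\<Sum>m\<in>S. b m * (k n m * c))"
        using h(3) c by (simp add: F_def b_def k_def)
      then have "b n \<le> (norm (\<integral>s. F s * complex_of_real (h s) \<partial>lebesgue_on {0..}) * \<nu> n powr (- 1 / q)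
            + (\<Sum>m\<in>S. b m * (k n m * c))) / c"
        using c by (simp add: pos_le_divide_eq mult.commute)
      also have "\<dots> = norm (\<integral>s. F s * complex_of_real (h s) \<partial>lebesgue_on {0..}) * \<nu> n powr (- 1 / q) / c
            + (\<Sum>m\<in>S. b m * k n m)"
        using c by (simp add: add_divide_distrib sum_divide_distrib)
      finally show ?thesis using h(1,2) unfolding P_def D_def by blast
    qed
    then obtain h where "\<And>n. n \<in> S \<Longrightarrow> P n (h n)" by metis
    then have h: "\<And>n. n \<in> S \<Longrightarrow> continuous_on {0..} (h n)"
      "\<And>n s. n \<in> S \<Longrightarrow> 0 \<le> s \<Longrightarrow> \<bar>h n s\<bar> \<le> D * (\<nu> n)\<^sup>2 * (s * exp (- (\<nu> n / (2 * R)) * s))"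
      "\<And>n. n \<in> S \<Longrightarrow> b n \<le> norm (\<integral>s. F s * complex_of_real (h n s) \<partial>lebesgue_on {0..}) * \<nu> n powr (- 1 / q) / c
            + (\<Sum>m\<in>S. b m * k n m)"
      unfolding P_def by blast+
    define \<phi> where "\<phi> n = norm (\<integral>s. F s * complex_of_real (h n s) \<partial>lebesgue_on {0..})" for n
    define u where "u n = \<phi> n * \<nu> n powr (- 1 / q) / c" for n
    have k_sum: "(\<Sum>m\<in>S. k n m) \<le> 1 / 4" for n
    proof -
      have "(\<Sum>m\<in>S. k n m) = R powr (- 1 / 2) / c * (\<Sum>m\<in>S. min (\<nu> m / \<nu> n) (\<nu> n / \<nu> m) powr (1 / 2))"
        by (simp add: k_def sum_distrib_left sum_divide_distrib)
      also have "\<dots> \<le> R powr (- 1 / 2) / c * T"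
        using lacunary_ratio_quotient_sum[OF \<nu>, of "1 / 2" S n] S c
        by (intro mult_left_mono) (auto simp: T_def)
      also have "\<dots> \<le> 1 / 4" using RT by simp
      finally show ?thesis .
    qed
    \<comment> \<open>By symmetry the column bounds for \<open>Schur_absorb\<close> are the row
      bounds.\<close>
    have k_sym: "(\<lambda>n. k n m) = k m" for m by (simp add: fun_eq_iff k_def min.commute)
    have b_u: "(\<Sum>n\<in>S. b n powr q) \<le> 2 * 2 powr q * (\<Sum>n\<in>S. u n powr q)"
    proof (rule Schur_absorb[where k = k, OF S q])
      show "(\<Sum>n\<in>S. k n m) \<le> 1 / 4" for m
        unfolding k_sym[where m = m] by (rule k_sum)
      show "b n \<le> u n + (\<Sum>m\<in>S. b m * k n m)" if "n \<in> S" for n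
        using h(3)[OF that] by (simp add: u_def \<phi>_def)
      show "0 \<le> k n m" for n m using c by (simp add: k_def)
      show "0 \<le> b n" for n by (simp add: b_def)
      show "0 \<le> u n" for n using c by (simp add: u_def \<phi>_def)
      show "(\<Sum>m\<in>S. k n m) \<le> 1 / 4" for n by (rule k_sum)
    qed
    have "(\<Sum>n\<in>S. u n powr q)
        \<le> (\<Sum>n\<in>S. c powr (- q) * (K powr (q - 1) *
            (\<integral>s. norm (F s) powr q * (\<bar>h n s\<bar> / \<nu> n) \<partial>lebesgue_on {0..})))"
    proof (rule sum_mono)
      fix n assume n: "n \<in> S"
      have \<kappa>: "0 < \<nu> n / (2 * R)" using \<nu>D(2)[of n] R by simp
      have "D * (\<nu> n)\<^sup>2 * (4 / (\<nu> n / (2 * R))\<^sup>2) = K"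
        using \<nu>D(2)[of n] R by (simp add: K_def field_simps power2_eq_square)
      then have "\<phi> n powr q \<le> K powr (q - 1) * (\<integral>s. norm (F s) powr q * \<bar>h n s\<bar> \<partial>lebesgue_on {0..})"
        unfolding \<phi>_def
        using powr_Jensen_pairing(1)[OF F_cont F_bound h(1)[OF n] \<kappa> h(2)[OF n] q _ K] by simp
      moreover have "u n powr q = (\<phi> n * \<nu> n powr (- 1 / q)) powr q / c powr q"
        unfolding u_def by (rule powr_divide)
      then have "u n powr q = c powr (- q) * (\<phi> n powr q / \<nu> n)"
        using powr_mult_powr_inverse[OF \<nu>D(2)[of n] _ q, of "\<phi> n"]
        by (simp add: \<phi>_def powr_minus_divide)
      ultimately have "u n powr q \<le> c powr (- q) *
          (K powr (q - 1) * (\<integral>s. norm (F s) powr q * \<bar>h n s\<bar> \<partial>lebesgue_on {0..}) / \<nu> n)"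
        using \<nu>D(2)[of n] by (simp only: mult_left_mono divide_right_mono less_imp_le powr_ge_zero)
      then show "u n powr q \<le> c powr (- q) * (K powr (q - 1) *
            (\<integral>s. norm (F s) powr q * (\<bar>h n s\<bar> / \<nu> n) \<partial>lebesgue_on {0..}))"
        by simp
    qed
    also have "\<dots> = c powr (- q) * K powr (q - 1) *
        (\<Sum>n\<in>S. \<integral>s. norm (F s) powr q * (\<bar>h n s\<bar> / \<nu> n) \<partial>lebesgue_on {0..})"
      by (simp add: sum_distrib_left mult.assoc)
    finally have u_I: "(\<Sum>n\<in>S. u n powr q) \<le> c powr (- q) * K powr (q - 1) *
        (\<Sum>n\<in>S. \<integral>s. norm (F s) powr q * (\<bar>h n s\<bar> / \<nu> n) \<partial>lebesgue_on {0..})" .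
    \<comment> \<open>After exchanging sum and integral, \<open>\<bar>h n s\<bar> / \<nu> n\<close>
      is at most \<open>D\<close> times
      \<open>(s * \<nu> n) * exp (- s * \<nu> n / (2 * R))\<close>. Summed over \<open>n\<close>
      this is at most \<open>D * C1\<close>, uniformly in \<open>s\<close>, because
      \<open>s * \<nu> n\<close> is lacunary with the same ratio.\<close>
    have I_le: "(\<Sum>n\<in>S. \<integral>s. norm (F s) powr q * (\<bar>h n s\<bar> / \<nu> n) \<partial>lebesgue_on {0..})
        \<le> D * C1 * (\<integral>s. norm (F s) powr q \<partial>lebesgue_on {0..})"
    proof -
      have int: "integrable (lebesgue_on {0..}) (\<lambda>s. norm (F s) powr q * (\<bar>h n s\<bar> / \<nu> n))" if n: "n \<in> S" for n
      proof -
        have \<kappa>: "0 < \<nu> n / (2 * R)" using \<nu>D(2)[of n] R by simp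
        have "integrable (lebesgue_on {0..}) (\<lambda>s. norm (F s) powr q * \<bar>h n s\<bar>)"
          by (rule powr_Jensen_pairing(2)[OF F_cont F_bound h(1)[OF n] \<kappa> h(2)[OF n] q, where K = "max 1 (D * (\<nu> n)\<^sup>2 * (4 / (\<nu> n / (2 * R))\<^sup>2))"])
            auto
        then show ?thesis by simp
      qed
      have "(\<Sum>n\<in>S. \<integral>s. norm (F s) powr q * (\<bar>h n s\<bar> / \<nu> n) \<partial>lebesgue_on {0..})
          = (\<integral>s. (\<Sum>n\<in>S. norm (F s) powr q * (\<bar>h n s\<bar> / \<nu> n)) \<partial>lebesgue_on {0..})"
        using int by (subst Bochner_Integration.integral_sum) auto
      also have "\<dots> \<le> (\<integral>s. D * C1 * norm (F s) powr q \<partial>lebesgue_on {0..})"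
      proof (rule integral_mono)
        show "integrable (lebesgue_on {0..}) (\<lambda>s. \<Sum>n\<in>S. norm (F s) powr q * (\<bar>h n s\<bar> / \<nu> n))"
          using int by (intro Bochner_Integration.integrable_sum)
        show "integrable (lebesgue_on {0..}) (\<lambda>s. D * C1 * norm (F s) powr q)"
          using integrable_exp_sum_powr[OF \<nu>, of q S a] q by (auto simp: F_def)
        fix s :: real assume "s \<in> space (lebesgue_on {0..})"
        then have s: "0 \<le> s" by simp
        have "(\<Sum>n\<in>S. \<bar>h n s\<bar> / \<nu> n) \<le> D * C1"
        \<comment> \<open>Scaling by 0 destroys positivity of the sequence, but at 0 all kernels
          vanish.\<close>
        proof (cases "s = 0")
          case True
          then have "(\<Sum>n\<in>S. \<bar>h n s\<bar> / \<nu> n) \<le> (\<Sum>n\<in>S. 0)"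
            using h(2)[of _ 0] \<nu>D(2) by (intro sum_mono) (auto simp: divide_le_0_iff)
          also have "\<dots> \<le> D * C1" using D C1(1) by simp
          finally show ?thesis .
        next
          case False
          with s have s0: "0 < s" by simp
          have "(\<Sum>n\<in>S. \<bar>h n s\<bar> / \<nu> n)
              \<le> (\<Sum>n\<in>S. D * ((s * \<nu> n) powr 1 * exp (- (1 / (2 * R)) * (s * \<nu> n))))"
          proof (rule sum_mono)
            fix n assume n: "n \<in> S"
            have "\<bar>h n s\<bar> / \<nu> n \<le> D * (\<nu> n)\<^sup>2 * (s * exp (- (\<nu> n / (2 * R)) * s)) / \<nu> n"
              using h(2)[OF n s] \<nu>D(2)[of n] by (intro divide_right_mono) auto
            also have "\<dots> = D * ((s * \<nu> n) powr 1 * exp (- (1 / (2 * R)) * (s * \<nu> n)))"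
              using \<nu>D(2)[of n] s by (simp add: power2_eq_square mult_ac)
            finally show "\<bar>h n s\<bar> / \<nu> n \<le> D * ((s * \<nu> n) powr 1 * exp (- (1 / (2 * R)) * (s * \<nu> n)))" .
          qed
          also have "\<dots> = D * (\<Sum>n\<in>S. (s * \<nu> n) powr 1 * exp (- (1 / (2 * R)) * (s * \<nu> n)))"
            by (simp only: sum_distrib_left)
          also have "\<dots> \<le> D * C1"
            using D by (intro mult_left_mono C1(2) lacunary_ratio_scale[OF \<nu> s0] S) auto
          finally show ?thesis .
        qed
        then have "norm (F s) powr q * (\<Sum>n\<in>S. \<bar>h n s\<bar> / \<nu> n) \<le> norm (F s) powr q * (D * C1)"
          by (intro mult_left_mono) auto
        then show "(\<Sum>n\<in>S. norm (F s) powr q * (\<bar>h n s\<bar> / \<nu> n)) \<le> D * C1 * norm (F s) powr q"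
          by (simp only: sum_distrib_left mult_ac)
      qed
      finally show ?thesis by simp
    qed
    have "c powr (- q) * K powr (q - 1) *
          (\<Sum>n\<in>S. \<integral>s. norm (F s) powr q * (\<bar>h n s\<bar> / \<nu> n) \<partial>lebesgue_on {0..})
        \<le> c powr (- q) * K powr (q - 1) * (D * C1 * (\<integral>s. norm (F s) powr q \<partial>lebesgue_on {0..}))"
      by (intro mult_left_mono I_le) auto
    with u_I have "2 * 2 powr q * (\<Sum>n\<in>S. u n powr q)
        \<le> 2 * 2 powr q * (c powr (- q) * K powr (q - 1) * (D * C1 * (\<integral>s. norm (F s) powr q \<partial>lebesgue_on {0..})))"
      by (intro mult_left_mono) auto
    with b_u have "(\<Sum>n\<in>S. b n powr q) \<le> C * (\<integral>s. norm (F s) powr q \<partial>lebesgue_on {0..})"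
      unfolding C_def by (simp only: mult.assoc)
    moreover have "b n powr q = norm (a n) powr q / \<nu> n" for n
      unfolding b_def by (rule powr_mult_powr_inverse[OF \<nu>D(2) norm_ge_zero q])
    ultimately show "(\<Sum>n\<in>S. norm (a n) powr q / \<nu> n)
        \<le> C * (\<integral>s. norm (exp_sum \<nu> S a s) powr q \<partial>lebesgue_on {0..})"
      by (simp add: F_def)
  qed
qed

section \<open>The norm with absolute coefficients controlled by the coefficients\<close>

lemma scaled_Gamma_integral:
  fixes \<gamma> \<nu> :: real
  assumes "0 < \<gamma>" "0 < \<nu>"
  shows "integrable (lebesgue_on {0..}) (\<lambda>s. (\<nu> * s) powr (\<gamma> - 1) * exp (- (\<nu> * s)))"
    and "(\<integral>s. (\<nu> * s) powr (\<gamma> - 1) * exp (- (\<nu> * s)) \<partial>lebesgue_on {0..}) = Gamma \<gamma> / \<nu>"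
proof -
  define f :: "real \<Rightarrow> real" where "f t = t powr (\<gamma> - 1) * exp (- t)" for t
  have f: "(f has_integral Gamma \<gamma>) {0..}"
    using Gamma_integral_real[OF assms(1)] by (simp add: f_def[abs_def] exp_minus divide_inverse)
  then have "f absolutely_integrable_on {0..}"
    by (intro nonnegative_absolutely_integrable_1) (auto simp: f_def)
  moreover have "(\<lambda>s. \<nu> * s) ` {0..} = {0..}"
  proof (intro equalityI subsetI)
    fix t :: real assume "t \<in> {0..}"
    then show "t \<in> (\<lambda>s. \<nu> * s) ` {0..}" using assms by (intro image_eqI[of _ _ "t / \<nu>"]) auto
  qed (use assms in auto)
  ultimately have cov: "(\<lambda>s. \<bar>\<nu>\<bar> * f (\<nu> * s)) absolutely_integrable_on {0..}
      \<and> integral {0..} (\<lambda>s. \<bar>\<nu>\<bar> * f (\<nu> * s)) = Gamma \<gamma>"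
    using assms f by (subst has_absolute_integral_change_of_variables_1'[where g = "\<lambda>s. \<nu> * s"])
      (auto intro!: derivative_eq_intros inj_onI simp: integral_unique)
  then have int: "integrable (lebesgue_on {0..}) (\<lambda>s. \<nu> * f (\<nu> * s))"
    using assms by (intro absolutely_integrable_imp_integrable) auto
  then show "integrable (lebesgue_on {0..}) (\<lambda>s. (\<nu> * s) powr (\<gamma> - 1) * exp (- (\<nu> * s)))"
    using assms by (simp add: f_def)
  have "(\<integral>s. \<nu> * f (\<nu> * s) \<partial>lebesgue_on {0..}) = Gamma \<gamma>"
    using cov assms lebesgue_integral_eq_integral[OF int] by simp
  then show "(\<integral>s. (\<nu> * s) powr (\<gamma> - 1) * exp (- (\<nu> * s)) \<partial>lebesgue_on {0..}) = Gamma \<gamma> / \<nu>"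
    using assms by (simp add: f_def field_simps)
qed

lemma norm_exp_sum_abs:
  "norm (exp_sum \<nu> S (\<lambda>n. complex_of_real (norm (a n))) s) = (\<Sum>n\<in>S. norm (a n) * exp (- \<nu> n * s))"
proof -
  have "exp_sum \<nu> S (\<lambda>n. complex_of_real (norm (a n))) s
      = complex_of_real (\<Sum>n\<in>S. norm (a n) * exp (- \<nu> n * s))"
    by (simp add: exp_sum_def)
  then show ?thesis
    by (simp only: norm_of_real) (simp add: sum_nonneg)
qed

text \<open>Each term is split as \<open>c n * w n\<close>, where the weights \<open>w n\<close>
  have a sum bounded uniformly in \<open>s\<close>. Jensen then moves the power \<open>q\<close>
  onto the single terms, whose integrals are Gamma integrals of order
  \<open>1 / \<nu> n\<close>.\<close>

lemma exp_sum_abs_le_coefficients: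
  fixes r q :: real
  assumes r: "1 < r" and q: "1 \<le> q"
  obtains C where "0 < C"
    "\<And>\<nu> S (a :: nat \<Rightarrow> complex). lacunary_ratio r \<nu> \<Longrightarrow> finite S \<Longrightarrow>
      (\<integral>s. norm (exp_sum \<nu> S (\<lambda>n. complex_of_real (norm (a n))) s) powr q \<partial>lebesgue_on {0..})
        \<le> C * (\<Sum>n\<in>S. norm (a n) powr q / \<nu> n)"
proof -
  define \<gamma> where "\<gamma> = 1 / q"
  have \<gamma>: "0 < \<gamma>" using q by (simp add: \<gamma>_def)
  obtain C1 where C1: "0 < C1" "\<And>y S. lacunary_ratio r y \<Longrightarrow> finite S \<Longrightarrow>
      (\<Sum>n\<in>S. y n powr \<gamma> * exp (- (1 / 2) * y n)) \<le> C1"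
    using lacunary_ratio_exp_sum[OF \<gamma> _ r, of "1 / 2"] by auto
  have G: "0 < Gamma \<gamma>" using \<gamma> by (rule Gamma_real_pos)
  show ?thesis
  proof (rule that[of "C1 powr (q - 1) * Gamma \<gamma>"])
    show "0 < C1 powr (q - 1) * Gamma \<gamma>" using C1 G by simp
    fix \<nu> :: "nat \<Rightarrow> real" and S :: "nat set" and a :: "nat \<Rightarrow> complex"
    assume \<nu>: "lacunary_ratio r \<nu>" and S: "finite S"
    note \<nu>D = lacunary_ratioD[OF \<nu>]
    define g where "g n s = norm (a n) powr q * ((\<nu> n * s) powr (\<gamma> - 1) * exp (- (\<nu> n * s)))" for n s
    have int_g: "integrable (lebesgue_on {0..}) (g n)" for n
      unfolding g_def using scaled_Gamma_integral(1)[OF \<gamma> \<nu>D(2)] by (rule integrable_mult_right)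
    have pointwise: "norm (exp_sum \<nu> S (\<lambda>n. complex_of_real (norm (a n))) s) powr q
        \<le> C1 powr (q - 1) * (\<Sum>n\<in>S. g n s)" if s: "0 < s" for s
    proof -
      \<comment> \<open>With \<open>\<gamma> = 1 / q\<close> the power \<open>q\<close> turns the
        factor \<open>(s * \<nu> n) powr (- \<gamma>)\<close> of \<open>c n\<close> into
        \<open>1 / (s * \<nu> n)\<close>. Multiplied by \<open>w n\<close> this leaves the exponent
        \<open>\<gamma> - 1 > -1\<close>, integrable at 0. Each of the two factors takes half of the
        exponential.\<close>
      define w where "w n = (s * \<nu> n) powr \<gamma> * exp (- (1 / 2) * (s * \<nu> n))" for n
      define c where "c n = norm (a n) * ((s * \<nu> n) powr (- \<gamma>) * exp (- (1 / 2) * (s * \<nu> n)))" for n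
      have y: "0 < s * \<nu> n" for n using s \<nu>D(2)[of n] by simp
      have cw: "norm (a n) * exp (- \<nu> n * s) = c n * w n" for n
      proof -
        have "(s * \<nu> n) powr (- \<gamma>) * (s * \<nu> n) powr \<gamma> = 1"
          using s \<nu>D(2)[of n] by (simp flip: powr_add)
        moreover have "exp (- (1 / 2) * (s * \<nu> n)) * exp (- (1 / 2) * (s * \<nu> n)) = exp (- \<nu> n * s)"
          by (simp flip: exp_add)
        ultimately show ?thesis unfolding c_def w_def by algebra
      qed
      have "norm (exp_sum \<nu> S (\<lambda>n. complex_of_real (norm (a n))) s) powr q = (\<Sum>n\<in>S. c n * w n) powr q"
        by (simp only: norm_exp_sum_abs cw)
      also have "\<dots> \<le> C1 powr (q - 1) * (\<Sum>n\<in>S. c n powr q * w n)"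
        using C1(2)[OF lacunary_ratio_scale[OF \<nu> s] S] C1(1) S q
        by (intro Jensen_powr_sum) (auto simp: c_def w_def)
      also have "\<dots> \<le> C1 powr (q - 1) * (\<Sum>n\<in>S. g n s)"
      proof (intro mult_left_mono sum_mono)
        fix n
        let ?y = "s * \<nu> n"
        have "c n powr q = norm (a n) powr q * ((?y powr (- \<gamma>)) powr q * exp (- (1 / 2) * ?y) powr q)"
          by (simp only: c_def powr_mult)
        also have "(?y powr (- \<gamma>)) powr q = ?y powr (- 1)"
          using q by (simp add: powr_powr \<gamma>_def)
        also have "exp (- (1 / 2) * ?y) powr q = exp (- (q / 2) * ?y)"
          by (simp add: exp_powr_real mult_ac)
        finally have "c n powr q * w n = norm (a n) powr q *
            ((?y powr (- 1) * ?y powr \<gamma>) * (exp (- (q / 2) * ?y) * exp (- (1 / 2) * ?y)))"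
          by (simp only: w_def mult_ac)
        also have "?y powr (- 1) * ?y powr \<gamma> = ?y powr (\<gamma> - 1)"
          by (simp only: uminus_add_conv_diff flip: powr_add)
        also have "exp (- (q / 2) * ?y) * exp (- (1 / 2) * ?y) = exp (- ((q + 1) / 2 * ?y))"
          by (simp add: field_simps flip: exp_add)
        \<comment> \<open>Since \<open>q \<ge> 1\<close>, the rate \<open>(q + 1) / 2\<close> is at
          least 1.\<close>
        also have "norm (a n) powr q * (?y powr (\<gamma> - 1) * exp (- ((q + 1) / 2 * ?y)))
            \<le> norm (a n) powr q * (?y powr (\<gamma> - 1) * exp (- ?y))"
          using y[of n] q mult_right_mono[of 1 "(q + 1) / 2" ?y]
          by (intro mult_left_mono) auto
        also have "\<dots> = g n s" by (simp add: g_def mult.commute)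
        finally show "c n powr q * w n \<le> g n s" .
      qed auto
      finally show ?thesis .
    qed
    have "(\<integral>s. norm (exp_sum \<nu> S (\<lambda>n. complex_of_real (norm (a n))) s) powr q \<partial>lebesgue_on {0..})
        \<le> (\<integral>s. C1 powr (q - 1) * (\<Sum>n\<in>S. g n s) \<partial>lebesgue_on {0..})"
    proof (rule integral_mono_AE)
      show "integrable (lebesgue_on {0..}) (\<lambda>s. norm (exp_sum \<nu> S (\<lambda>n. complex_of_real (norm (a n))) s) powr q)"
        using q by (intro integrable_exp_sum_powr[OF \<nu>]) auto
      show "integrable (lebesgue_on {0..}) (\<lambda>s. C1 powr (q - 1) * (\<Sum>n\<in>S. g n s))"
        using int_g by (intro integrable_mult_right Bochner_Integration.integrable_sum) auto
      \<comment> \<open>The point 0 is excluded because \<open>0 powr (\<gamma> - 1) = 0\<close>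
        makes every \<open>g n 0\<close> vanish, while the left-hand side does not vanish there in
        general.\<close>
      have "AE s in lebesgue. s \<noteq> (0::real)"
        by (rule AE_completion[OF AE_lborel_singleton])
      then show "AE s in lebesgue_on {0..}. norm (exp_sum \<nu> S (\<lambda>n. complex_of_real (norm (a n))) s) powr q
          \<le> C1 powr (q - 1) * (\<Sum>n\<in>S. g n s)"
        by (subst AE_restrict_space_iff) (auto elim!: eventually_mono intro!: pointwise)
    qed
    also have "\<dots> = C1 powr (q - 1) * (\<Sum>n\<in>S. \<integral>s. g n s \<partial>lebesgue_on {0..})"
      using int_g by (simp add: Bochner_Integration.integral_sum)
    also have "(\<Sum>n\<in>S. \<integral>s. g n s \<partial>lebesgue_on {0..}) = (\<Sum>n\<in>S. norm (a n) powr q * (Gamma \<gamma> / \<nu> n))"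
      unfolding g_def by (simp only: integral_mult_right_zero scaled_Gamma_integral(2)[OF \<gamma> \<nu>D(2)])
    also have "C1 powr (q - 1) * \<dots> = C1 powr (q - 1) * Gamma \<gamma> * (\<Sum>n\<in>S. norm (a n) powr q / \<nu> n)"
      by (simp add: sum_distrib_left mult_ac)
    finally show "(\<integral>s. norm (exp_sum \<nu> S (\<lambda>n. complex_of_real (norm (a n))) s) powr q \<partial>lebesgue_on {0..})
        \<le> C1 powr (q - 1) * Gamma \<gamma> * (\<Sum>n\<in>S. norm (a n) powr q / \<nu> n)" .
  qed
qed

lemma exp_sum_abs_le_exp_sum:
  fixes r q :: real
  assumes r: "1 < r" and q: "1 \<le> q"
  obtains C where "0 < C"
    "\<And>\<nu> S (a :: nat \<Rightarrow> complex). lacunary_ratio r \<nu> \<Longrightarrow> finite S \<Longrightarrow>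
      (\<integral>s. norm (exp_sum \<nu> S (\<lambda>n. complex_of_real (norm (a n))) s) powr q \<partial>lebesgue_on {0..})
        \<le> C * (\<integral>s. norm (exp_sum \<nu> S a s) powr q \<partial>lebesgue_on {0..})"
proof -
  obtain A where A: "0 < A"
    "\<And>\<nu> S (a :: nat \<Rightarrow> complex). lacunary_ratio r \<nu> \<Longrightarrow> finite S \<Longrightarrow>
      (\<integral>s. norm (exp_sum \<nu> S (\<lambda>n. complex_of_real (norm (a n))) s) powr q \<partial>lebesgue_on {0..})
        \<le> A * (\<Sum>n\<in>S. norm (a n) powr q / \<nu> n)"
    using exp_sum_abs_le_coefficients[OF assms] by blast
  obtain B where B: "0 < B"
    "\<And>\<nu> S (a :: nat \<Rightarrow> complex). lacunary_ratio r \<nu> \<Longrightarrow> finite S \<Longrightarrow>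
      (\<Sum>n\<in>S. norm (a n) powr q / \<nu> n)
        \<le> B * (\<integral>s. norm (exp_sum \<nu> S a s) powr q \<partial>lebesgue_on {0..})"
    using exp_sum_coefficients_le[OF assms] by blast
  show ?thesis
  proof (rule that[of "A * B"])
    show "0 < A * B" using A B by simp
    fix \<nu> :: "nat \<Rightarrow> real" and S :: "nat set" and a :: "nat \<Rightarrow> complex"
    assume *: "lacunary_ratio r \<nu>" "finite S"
    show "(\<integral>s. norm (exp_sum \<nu> S (\<lambda>n. complex_of_real (norm (a n))) s) powr q \<partial>lebesgue_on {0..})
        \<le> A * B * (\<integral>s. norm (exp_sum \<nu> S a s) powr q \<partial>lebesgue_on {0..})"
      using order_trans[OF A(2)[OF *, of a] mult_left_mono[OF B(2)[OF *, of a]]] A(1)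
      by (simp add: mult.assoc)
  qed
qed

text \<open>The Jacobian \<open>exp (- s)\<close> of \<open>t = exp (- s)\<close> is the
  \<open>q\<close>-th power of \<open>exp (- s / q)\<close>; pulled inside the norm, it shifts every
  exponent by \<open>1 / q\<close>.\<close>

lemma muntz_integral_eq_exp_sum:
  fixes \<Lambda> :: "nat \<Rightarrow> real" and a :: "nat \<Rightarrow> complex" and S :: "nat set"
  assumes \<nu>: "lacunary_ratio r (\<lambda>n. \<Lambda> n + 1 / q)" and q: "0 < q"
  defines "f \<equiv> \<lambda>t. norm (\<Sum>n\<in>S. a n * complex_of_real (t powr \<Lambda> n)) powr q"
  shows "integrable (lebesgue_on {0..1}) f"
    and "integral\<^sup>L (lebesgue_on {0..1}) f
      = (\<integral>s. norm (exp_sum (\<lambda>n. \<Lambda> n + 1 / q) S a s) powr q \<partial>lebesgue_on {0..})"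
proof -
  let ?E = "\<lambda>s. norm (exp_sum (\<lambda>n. \<Lambda> n + 1 / q) S a s) powr q"
  have E: "\<bar>- exp (- s)\<bar> * f (exp (- s)) = ?E s" for s
  proof -
    have "exp_sum (\<lambda>n. \<Lambda> n + 1 / q) S a s
        = complex_of_real (exp (- (1 / q) * s)) * (\<Sum>n\<in>S. a n * complex_of_real (exp (- s) powr \<Lambda> n))"
      unfolding exp_sum_def sum_distrib_left
    proof (rule sum.cong[OF refl])
      fix n
      have "exp (- (\<Lambda> n + 1 / q) * s) = exp (- (1 / q) * s) * exp (- s) powr \<Lambda> n"
        by (simp add: exp_powr_real algebra_simps flip: exp_add)
      then show "a n * complex_of_real (exp (- (\<Lambda> n + 1 / q) * s))
          = complex_of_real (exp (- (1 / q) * s)) * (a n * complex_of_real (exp (- s) powr \<Lambda> n))"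
        by (simp only: of_real_mult mult_ac)
    qed
    moreover have "exp (- (1 / q) * s) powr q = exp (- s)"
      using q by (simp add: exp_powr_real)
    ultimately show ?thesis
      by (simp add: f_def norm_mult powr_mult)
  qed
  have int_E: "integrable (lebesgue_on {0..}) ?E"
    by (rule integrable_exp_sum_powr[OF \<nu> q])
  have "?E absolutely_integrable_on {0..}"
    using int_E by (simp add: set_integrable_def integrable_restrict_space)
  moreover have "integral {0..} ?E = integral\<^sup>L (lebesgue_on {0..}) ?E"
    using lebesgue_integral_eq_integral[OF int_E] by simp
  moreover have "(\<lambda>s::real. exp (- s)) ` {0..} = {0<..1}"
  proof (intro equalityI subsetI)
    fix t :: real assume "t \<in> {0<..1}"
    then show "t \<in> (\<lambda>s::real. exp (- s)) ` {0..}" by (intro image_eqI[of _ _ "- ln t"]) auto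
  qed auto
  moreover have "(\<lambda>s. \<bar>- exp (- s)\<bar> * f (exp (- s))) absolutely_integrable_on {0..}
      \<and> integral {0..} (\<lambda>s. \<bar>- exp (- s)\<bar> * f (exp (- s))) = b
    \<longleftrightarrow> f absolutely_integrable_on (\<lambda>s. exp (- s)) ` {0..}
      \<and> integral ((\<lambda>s. exp (- s)) ` {0..}) f = b" for b
    by (rule has_absolute_integral_change_of_variables_1')
      (auto intro!: derivative_eq_intros inj_onI)
  ultimately have cov: "f absolutely_integrable_on {0<..1}
      \<and> integral {0<..1} f = integral\<^sup>L (lebesgue_on {0..}) ?E"
    unfolding E by metis
  \<comment> \<open>The substitution reaches \<open>{0<..1}\<close> only; the endpoint 0 is a null
    set.\<close>
  have "{t \<in> {0<..1} - {0..1}. f t \<noteq> 0} \<subseteq> {0}" "{t \<in> {0..1} - {0<..1}. f t \<noteq> 0} \<subseteq> {0}"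
    by auto
  then have spike: "negligible {t \<in> {0<..1} - {0..1}. f t \<noteq> 0}"
      "negligible {t \<in> {0..1} - {0<..1}. f t \<noteq> 0}"
    using negligible_subset[OF negligible_sing] by blast+
  have "f absolutely_integrable_on {0..1}"
    using cov absolutely_integrable_spike_set_eq[OF spike] by blast
  then show int: "integrable (lebesgue_on {0..1}) f"
    by (rule absolutely_integrable_imp_integrable) simp
  have "integral {0..1} f = integral {0<..1} f"
    by (rule integral_spike_set[OF spike(2,1)])
  then show "integral\<^sup>L (lebesgue_on {0..1}) f = integral\<^sup>L (lebesgue_on {0..}) ?E"
    using cov lebesgue_integral_eq_integral[OF int] by simp
qed

section \<open>Sublinear measures\<close>

text \<open>On each dyadic interval \<open>I k\<close> the function is at most its value at the
  right end, which is at most its values on \<open>I (Suc k)\<close>. The Lebesgue measure of that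
  next interval is comparable to the bound for the measure of \<open>I k\<close>.\<close>

lemma mono_integral_sublinear_le:
  assumes fin: "finite_measure \<mu>" and sets: "sets \<mu> = sets (restrict_space borel {0..<1})"
    and sub: "sublinear \<mu>"
  obtains C :: real where "0 < C"
    "\<And>G :: real \<Rightarrow> real. (\<And>x y. 0 \<le> x \<Longrightarrow> x \<le> y \<Longrightarrow> y \<le> 1 \<Longrightarrow> G x \<le> G y) \<Longrightarrow>
      (\<integral>\<^sup>+ t. ennreal (G t) \<partial>\<mu>) \<le> ennreal C * (\<integral>\<^sup>+ t. ennreal (G t) \<partial>lebesgue_on {0..1})"
proof -
  interpret finite_measure \<mu> by (rule fin)
  have space: "space \<mu> = {0..<1}"
    using sets_eq_imp_space_eq[OF sets] by (simp add: space_restrict_space)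
  have meas: "A \<inter> {0..<1} \<in> sets \<mu>" if "A \<in> sets borel" for A
    using that unfolding sets by (auto simp: sets_restrict_space)
  obtain C0 where C0: "0 < C0"
    "\<And>\<epsilon>. 0 < \<epsilon> \<Longrightarrow> \<epsilon> < 1 \<Longrightarrow> emeasure \<mu> ({1 - \<epsilon>..1} \<inter> space \<mu>) \<le> ennreal (C0 * \<epsilon>)"
    using sub unfolding sublinear_def by auto
  \<comment> \<open>Sublinearity covers \<open>\<epsilon> < 1\<close>, that is \<open>k > 0\<close>;
    the total mass takes care of \<open>I 0\<close>, where \<open>\<epsilon>\<close> would be
    1.\<close>
  define C where "C = max C0 (measure \<mu> (space \<mu>))"
  define x :: "nat \<Rightarrow> real" where "x k = 1 - (1 / 2) ^ k" for k
  define I where "I k = {x k..<x (Suc k)}" for k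
  have x: "0 \<le> x k" "x k < x (Suc k)" "x k < 1" for k
    by (simp_all add: x_def power_le_one)
  have x_mono: "x i \<le> x j" if "i \<le> j" for i j
    using that by (auto simp: x_def intro!: power_decreasing)
  have "disjoint_family I"
    unfolding disjoint_family_on_def
  proof (intro ballI impI)
    fix i j :: nat assume "i \<noteq> j"
    then consider "Suc i \<le> j" | "Suc j \<le> i" by linarith
    then show "I i \<inter> I j = {}"
      using x_mono[of "Suc i" j] x_mono[of "Suc j" i] by cases (auto simp: I_def)
  qed
  have cover: "\<exists>k. t \<in> I k" if t: "0 \<le> t" "t < 1" for t
  proof -
    obtain n where "(1 / 2) ^ n < 1 - t"
      using real_arch_pow_inv[of "1 - t" "1 / 2"] t by auto
    then have ex: "\<exists>n. t < x n" by (intro exI[of _ n]) (simp add: x_def)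
    define m where "m = (LEAST n. t < x n)"
    have m: "t < x m" unfolding m_def using ex by (rule LeastI_ex)
    then have "m \<noteq> 0" using t by (intro notI) (simp add: x_def)
    then obtain k where k: "m = Suc k" using not0_implies_Suc by blast
    have "\<not> t < x k" using not_less_Least[of k "\<lambda>n. t < x n"] k by (simp add: m_def)
    then show ?thesis using m k by (intro exI[of _ k]) (auto simp: I_def)
  qed
  have \<mu>_I: "emeasure \<mu> (I k \<inter> {0..<1}) \<le> ennreal (C * (1 / 2) ^ k)" for k
  proof (cases "k = 0")
    case True
    have "emeasure \<mu> (I k \<inter> {0..<1}) \<le> emeasure \<mu> (space \<mu>)" by (rule emeasure_space)
    also have "\<dots> \<le> ennreal C" by (auto simp: emeasure_eq_measure C_def intro!: ennreal_leI)
    finally show ?thesis using True by simp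
  next
    case False
    then have "(1 / 2 :: real) ^ k < 1" using power_strict_decreasing[of 0 k "1 / 2 :: real"] by simp
    then have "emeasure \<mu> ({1 - (1 / 2) ^ k..1} \<inter> space \<mu>) \<le> ennreal (C0 * (1 / 2) ^ k)"
      by (intro C0(2)) auto
    also have "\<dots> \<le> ennreal (C * (1 / 2) ^ k)"
      by (intro ennreal_leI mult_right_mono) (auto simp: C_def)
    finally have "emeasure \<mu> ({1 - (1 / 2) ^ k..1} \<inter> space \<mu>) \<le> ennreal (C * (1 / 2) ^ k)" .
    moreover have "emeasure \<mu> (I k \<inter> {0..<1}) \<le> emeasure \<mu> ({1 - (1 / 2) ^ k..1} \<inter> space \<mu>)"
      unfolding space using x(3)[of "Suc k"]
      by (intro emeasure_mono meas) (auto simp: I_def x_def)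
    ultimately show ?thesis by simp
  qed
  have I_meas: "I k \<inter> {0..<1} \<in> sets \<mu>" for k by (rule meas) (simp add: I_def)
  have I_meas': "I k \<in> sets lebesgue" for k by (simp add: I_def)
  have C: "0 < C" using C0 by (simp add: C_def)
  show ?thesis
  proof (rule that[of "4 * C"])
    show "0 < 4 * C" using C by simp
    fix G :: "real \<Rightarrow> real"
    assume G: "\<And>x y. 0 \<le> x \<Longrightarrow> x \<le> y \<Longrightarrow> y \<le> 1 \<Longrightarrow> G x \<le> G y"
    let ?g = "\<lambda>k. ennreal (G (x (Suc k)))"
    have "(\<integral>\<^sup>+ t. ennreal (G t) \<partial>\<mu>) \<le> (\<integral>\<^sup>+ t. (\<Sum>k. ?g k * indicator (I k \<inter> {0..<1}) t) \<partial>\<mu>)"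
    proof (rule nn_integral_mono)
      fix t assume "t \<in> space \<mu>"
      then have t: "0 \<le> t" "t < 1" by (auto simp: space)
      then obtain k where k: "t \<in> I k" using cover by blast
      have "disjoint_family (\<lambda>k. I k \<inter> {0..<1})"
        using \<open>disjoint_family I\<close> by (auto simp: disjoint_family_on_def)
      then have "(\<Sum>k. ?g k * indicator (I k \<inter> {0..<1}) t) = ?g k"
        using k t by (intro suminf_cmult_indicator) auto
      moreover have "G t \<le> G (x (Suc k))" using k t x(3)[of "Suc k"] by (intro G) (auto simp: I_def)
      ultimately show "ennreal (G t) \<le> (\<Sum>k. ?g k * indicator (I k \<inter> {0..<1}) t)"
        by (simp add: ennreal_leI)
    qed
    also have "\<dots> = (\<Sum>k. ?g k * emeasure \<mu> (I k \<inter> {0..<1}))"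
      using I_meas by (subst nn_integral_suminf) (simp_all add: nn_integral_cmult_indicator)
    also have "\<dots> \<le> (\<Sum>k. ennreal (4 * C) * (?g k * emeasure lebesgue (I (Suc k))))"
    proof (intro suminf_le)
      fix k
      \<comment> \<open>The shift by one interval leaves length \<open>(1 / 2) ^ (k + 2)\<close>,
        the source of the factor 4.\<close>
      have "emeasure lebesgue (I (Suc k)) = ennreal (x (Suc (Suc k)) - x (Suc k))"
        using x(2)[of "Suc k"] by (simp add: I_def)
      also have "\<dots> = ennreal ((1 / 2) ^ k / 4)" by (simp add: x_def)
      finally have "ennreal (4 * C) * emeasure lebesgue (I (Suc k)) = ennreal (C * (1 / 2) ^ k)"
        using C by (simp flip: ennreal_mult)
      then show "?g k * emeasure \<mu> (I k \<inter> {0..<1}) \<le> ennreal (4 * C) * (?g k * emeasure lebesgue (I (Suc k)))"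
        using mult_left_mono[OF \<mu>_I[of k], of "?g k"] by (simp add: mult.left_commute)
    qed auto
    also have "\<dots> = ennreal (4 * C) * (\<Sum>k. ?g k * emeasure lebesgue (I (Suc k)))"
      by (rule ennreal_suminf_cmult)
    also have "(\<Sum>k. ?g k * emeasure lebesgue (I (Suc k))) = (\<integral>\<^sup>+ t. (\<Sum>k. ?g k * indicator (I (Suc k)) t) \<partial>lebesgue)"
      using I_meas' by (subst nn_integral_suminf) (simp_all add: nn_integral_cmult_indicator)
    also have "\<dots> \<le> (\<integral>\<^sup>+ t. ennreal (G t) * indicator {0..1} t \<partial>lebesgue)"
    proof (rule nn_integral_mono)
      fix t :: real
      show "(\<Sum>k. ?g k * indicator (I (Suc k)) t) \<le> ennreal (G t) * indicator {0..1} t"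
      proof (cases "\<exists>k. t \<in> I (Suc k)")
        case True
        then obtain k where k: "t \<in> I (Suc k)" by blast
        have "disjoint_family (\<lambda>k. I (Suc k))"
          using \<open>disjoint_family I\<close> by (auto simp: disjoint_family_on_def)
        then have "(\<Sum>k. ?g k * indicator (I (Suc k)) t) = ?g k"
          using k by (intro suminf_cmult_indicator)
        moreover have "0 \<le> t" "t \<le> 1" using k x(1)[of "Suc k"] x(3)[of "Suc (Suc k)"] by (auto simp: I_def)
        moreover have "G (x (Suc k)) \<le> G t"
          using k x(1)[of "Suc k"] \<open>t \<le> 1\<close> by (intro G) (auto simp: I_def)
        ultimately show ?thesis by (simp add: ennreal_leI)
      qed simp
    qed
    also have "\<dots> = (\<integral>\<^sup>+ t. ennreal (G t) \<partial>lebesgue_on {0..1})"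
      by (simp add: nn_integral_restrict_space)
    finally show "(\<integral>\<^sup>+ t. ennreal (G t) \<partial>\<mu>)
        \<le> ennreal (4 * C) * (\<integral>\<^sup>+ t. ennreal (G t) \<partial>lebesgue_on {0..1})"
      by (simp add: mult_left_mono)
  qed
qed

text \<open>The quotient \<open>(r * x + \<sigma>) / (x + \<sigma>)\<close> increases with
  \<open>x\<close>, so its value at the smallest exponent \<open>\<Lambda> 0\<close> is a ratio
  valid for all \<open>n\<close>.\<close>

lemma lacunary_shift:
  assumes \<Lambda>: "lacunary_ratio r \<Lambda>" and \<sigma>: "0 \<le> \<sigma>"
  shows "lacunary_ratio ((r * \<Lambda> 0 + \<sigma>) / (\<Lambda> 0 + \<sigma>)) (\<lambda>n. \<Lambda> n + \<sigma>)"
  unfolding lacunary_ratio_def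
proof (intro conjI allI)
  note \<Lambda>D = lacunary_ratioD[OF \<Lambda>]
  have pos: "0 < \<Lambda> 0 + \<sigma>" using \<Lambda>D(2)[of 0] \<sigma> by simp
  then show "1 < (r * \<Lambda> 0 + \<sigma>) / (\<Lambda> 0 + \<sigma>)"
    using \<Lambda>D(1) \<Lambda>D(2)[of 0] by (simp add: less_divide_eq)
  fix n
  show "0 < \<Lambda> n + \<sigma>" using \<Lambda>D(2)[of n] \<sigma> by simp
  \<comment> \<open>This is the monotonicity of that quotient after cross-multiplication.\<close>
  have "0 \<le> (r - 1) * (\<Lambda> n - \<Lambda> 0) * \<sigma>"
    using \<Lambda>D(1) lacunary_ratio_ge_first[OF \<Lambda>, of n] \<sigma> by simp
  then have "(r * \<Lambda> 0 + \<sigma>) * (\<Lambda> n + \<sigma>) \<le> (r * \<Lambda> n + \<sigma>) * (\<Lambda> 0 + \<sigma>)"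
    by (simp add: algebra_simps)
  then have "(r * \<Lambda> 0 + \<sigma>) / (\<Lambda> 0 + \<sigma>) * (\<Lambda> n + \<sigma>) \<le> r * \<Lambda> n + \<sigma>"
    using pos by (simp add: pos_divide_le_eq)
  also have "\<dots> \<le> \<Lambda> (Suc n) + \<sigma>" using \<Lambda>D(3) by simp
  finally show "(r * \<Lambda> 0 + \<sigma>) / (\<Lambda> 0 + \<sigma>) * (\<Lambda> n + \<sigma>) \<le> \<Lambda> (Suc n) + \<sigma>" .
qed

theorem corollary4p7:
  fixes \<mu> :: "real measure" and \<Lambda> :: "nat \<Rightarrow> real" and q :: real
  assumes "finite_measure \<mu>"
    and "sets \<mu> = sets (restrict_space borel {0..<1})"
    and "\<And>n. \<Lambda> n > 0"
    and "sublinear \<mu>"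
    and "lacunary \<Lambda>"
    and "q \<ge> 1"
  shows "carleson_measure \<mu> \<Lambda> q"
proof -
  obtain r0 where "lacunary_ratio r0 \<Lambda>"
    using assms(3,5) by (auto simp: lacunary_def lacunary_ratio_def)
  then obtain r where \<nu>: "lacunary_ratio r (\<lambda>n. \<Lambda> n + 1 / q)"
    using lacunary_shift[of r0 \<Lambda> "1 / q"] assms(6) by auto
  have q: "0 < q" using assms(6) by simp
  obtain A :: real where A: "0 < A"
    "\<And>G :: real \<Rightarrow> real. (\<And>x y. 0 \<le> x \<Longrightarrow> x \<le> y \<Longrightarrow> y \<le> 1 \<Longrightarrow> G x \<le> G y) \<Longrightarrow>
      (\<integral>\<^sup>+ t. ennreal (G t) \<partial>\<mu>) \<le> ennreal A * (\<integral>\<^sup>+ t. ennreal (G t) \<partial>lebesgue_on {0..1})"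
    using mono_integral_sublinear_le[OF assms(1,2,4)] by blast
  obtain B where B: "0 < B"
    "\<And>\<nu> S (a :: nat \<Rightarrow> complex). lacunary_ratio r \<nu> \<Longrightarrow> finite S \<Longrightarrow>
      (\<integral>s. norm (exp_sum \<nu> S (\<lambda>n. complex_of_real (norm (a n))) s) powr q \<partial>lebesgue_on {0..})
        \<le> B * (\<integral>s. norm (exp_sum \<nu> S a s) powr q \<partial>lebesgue_on {0..})"
    using exp_sum_abs_le_exp_sum[OF lacunary_ratioD(1)[OF \<nu>] assms(6)] by blast
  show ?thesis
    unfolding carleson_measure_def
  proof (intro exI[of _ "(A * B) powr (1 / q)"] ballI)
    fix f assume "f \<in> muntz_polynomials \<Lambda>"
    then obtain S a where S: "finite S"
      and f: "f = (\<lambda>t. \<Sum>n\<in>S. a n * complex_of_real (t powr \<Lambda> n))"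
      unfolding muntz_polynomials_def by blast
    define I where "I = (\<integral>t. norm (f t) powr q \<partial>lebesgue_on {0..1})"
    \<comment> \<open>The majorant of \<open>norm (f t) powr q\<close> with absolute coefficients.
      This complex form fits \<open>muntz_integral_eq_exp_sum\<close>; the real form
      \<open>H_eq\<close> shows that it is nondecreasing, as the comparison of \<open>\<mu>\<close>
      with Lebesgue measure demands.\<close>
    define H where "H t = norm (\<Sum>n\<in>S. complex_of_real (norm (a n)) * complex_of_real (t powr \<Lambda> n)) powr q" for t
    have H_eq: "H t = (\<Sum>n\<in>S. norm (a n) * t powr \<Lambda> n) powr q" for t
    proof -
      have "(\<Sum>n\<in>S. complex_of_real (norm (a n)) * complex_of_real (t powr \<Lambda> n))
          = complex_of_real (\<Sum>n\<in>S. norm (a n) * t powr \<Lambda> n)" by simp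
      then show ?thesis unfolding H_def by (simp only: norm_of_real) (simp add: sum_nonneg)
    qed
    have H_nonneg: "0 \<le> H t" for t by (simp add: H_def)
    note H_int = muntz_integral_eq_exp_sum[OF \<nu> q, where S = S and a = "\<lambda>n. complex_of_real (norm (a n))",
        folded H_def]
    have H_le: "integral\<^sup>L (lebesgue_on {0..1}) H \<le> B * I"
      unfolding H_int(2) I_def f muntz_integral_eq_exp_sum(2)[OF \<nu> q] by (rule B(2)[OF \<nu> S])
    have "(\<integral>\<^sup>+ t. ennreal (norm (f t) powr q) \<partial>\<mu>) \<le> (\<integral>\<^sup>+ t. ennreal (H t) \<partial>\<mu>)"
    proof (intro nn_integral_mono ennreal_leI)
      fix t
      have "norm (f t) \<le> (\<Sum>n\<in>S. norm (a n) * t powr \<Lambda> n)"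
        unfolding f by (rule order_trans[OF norm_sum]) (simp add: norm_mult)
      then show "norm (f t) powr q \<le> H t" unfolding H_eq using q by (intro powr_mono2) auto
    qed
    also have "\<dots> \<le> ennreal A * (\<integral>\<^sup>+ t. ennreal (H t) \<partial>lebesgue_on {0..1})"
    proof (rule A(2))
      fix x y :: real assume "0 \<le> x" "x \<le> y"
      then show "H x \<le> H y"
        unfolding H_eq using q less_imp_le[OF assms(3)]
        by (intro powr_mono2 sum_mono mult_left_mono sum_nonneg) auto
    qed
    also have "\<dots> = ennreal A * ennreal (integral\<^sup>L (lebesgue_on {0..1}) H)"
      using nn_integral_eq_integral[OF H_int(1)] H_nonneg by simp
    also have "\<dots> \<le> ennreal A * ennreal (B * I)"
      by (intro mult_left_mono ennreal_leI H_le) auto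
    also have "\<dots> = ennreal (A * B * I)"
      using A(1) by (simp add: ennreal_mult' mult.assoc)
    finally have le: "(\<integral>\<^sup>+ t. ennreal (norm (f t) powr q) \<partial>\<mu>) \<le> ennreal (A * B * I)" .
    have I: "0 \<le> I" unfolding I_def by (intro Bochner_Integration.integral_nonneg) auto
    then have "(\<integral>t. norm (f t) powr q \<partial>\<mu>) \<le> A * B * I"
      using le A(1) B(1) by (intro integral_real_bounded) auto
    then have "(\<integral>t. norm (f t) powr q \<partial>\<mu>) powr (1 / q) \<le> (A * B * I) powr (1 / q)"
      using q by (intro powr_mono2) auto
    then show "Lq_norm \<mu> q f \<le> (A * B) powr (1 / q) * Lq_norm (lebesgue_on {0..1}) q f"
      using A(1) B(1) I by (simp add: Lq_norm_def I_def powr_mult)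
  qed
qed

end
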